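(* Let $K$ be a field, $P=K[x_1,\dots,x_n]$, let $\mathcal{O}=\{t_1,\dots,t_\mu\}$ be a (nonempty) order ideal of monomials in $P$ and let $\sigma$ be a term ordering on $\mathbb{T}^n$. Then: a) The classes of the elements of $\mathcal{O}$ form a $B_{\mathcal{O}}/\overline{L}_{\mathcal{O},\sigma}$-module basis of $U_{\mathcal{O}}/\overline{L}_{\mathcal{O},\sigma}$. b) The classes of the elements of $\mathcal{O}$ form a $G_{\mathcal{O},\sigma}$-module basis of $U_{\mathcal{O},\sigma}$. c) $I(\mathbb{G}_{\mathcal{O},\sigma})+(g_1^*,\dots,g_\eta^* )=\Theta^{-1}\big(L_{\mathcal{O},\sigma}+I(\mathbb{B}_{\mathcal{O}})+(g_1,\dots,g_\nu)\big)$, where $\Theta:K[\mathbf{x},S_{c\mathcal{O},\sigma}]\to K[\mathbf{x},\mathbf{c}]$ is the natural inclusion (and the ideal in parentheses is the ideal of $K[\mathbf{x},\mathbf{c}]$ generated by the indicated sets). d) The canonical homomorphisms $\varphi:G_{\mathcal{O},\sigma}\to B_{\mathcal{O}}/\overline{L}_{\mathcal{O},\sigma}$ and $\vartheta:U_{\mathcal{O},\sigma}\to U_{\mathcal{O}}/\overline{L}_{\mathcal{O},\sigma}$, induced by the inclusions $K[S_{c\mathcal{O},\sigma}]\subseteq K[\mathbf{c}]$ and $\Theta$ respectively, are isomorphisms.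
   Context: Notation: $P=K[x_1,\dots,x_n]$, $\mathbf{x}=x_1,\dots,x_n$, $\mathbb{T}^n=\{x_1^{\alpha_1}\cdots x_n^{\alpha_n}\mid\alpha_i\ge0\}$. An order ideal is a finite set $\mathcal{O}=\{t_1,\dots,t_\mu\}\subset\mathbb{T}^n$ (here nonempty) closed under taking divisors. Its border is $\partial\mathcal{O}=(x_1\mathcal{O}\cup\dots\cup x_n\mathcal{O})\setminus\mathcal{O}=\{b_1,\dots,b_\nu\}$. The corners $c\mathcal{O}\subseteq\partial\mathcal{O}$ are the minimal generators of the monoid ideal $\mathbb{T}^n\setminus\mathcal{O}$; the labelling is chosen so that $c\mathcal{O}=\{b_1,\dots,b_\eta\}$, $\eta\le\nu$. Let $\mathbf{c}=\{c_{ij}\mid 1\le i\le\mu,1\le j\le\nu\}$ be new indeterminates. Generic border prebasis: $g_j=b_j-\sum_{i=1}^\mu c_{ij}t_i$ for $j=1,\dots,\nu$. For $k=1,\dots,n$ the generic multiplication matrix $\mathcal{A}_k\in\mathrm{Mat}_\mu(K[\mathbf{c}])$ has $(i,j)$ entry $\delta_{im}$ if $x_kt_j=t_m\in\mathcal{O}$, and $c_{im}$ if $x_kt_j=b_m\in\partial\mathcal{O}$. $I(\mathbb{B}_{\mathcal{O}})\subseteq K[\mathbf{c}]$ is the ideal generated by all entries of all $\mathcal{A}_k\mathcal{A}_\ell-\mathcal{A}_\ell\mathcal{A}_k$, $1\le k<\ell\le n$; $B_{\mathcal{O}}=K[\mathbf{c}]/I(\mathbb{B}_{\mathcal{O}})$;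 $U_{\mathcal{O}}=K[\mathbf{x},\mathbf{c}]/(I(\mathbb{B}_{\mathcal{O}})+(g_1,\dots,g_\nu))$. $S_{\mathcal{O},\sigma}=\{c_{ij}\mid b_j>_\sigma t_i\}$; $L_{\mathcal{O},\sigma}$ is the ideal of $K[\mathbf{c}]$ generated by the $c_{ij}\notin S_{\mathcal{O},\sigma}$; $S_{c\mathcal{O},\sigma}=\{c_{ij}\in S_{\mathcal{O},\sigma}\mid j\le\eta\}$. For $j=1,\dots,\nu$ let $g_j^*=b_j-\sum_{\{i\mid b_j>_\sigma t_i\}}c_{ij}t_i$. $I(\mathbb{G}_{\mathcal{O},\sigma})=(L_{\mathcal{O},\sigma}+I(\mathbb{B}_{\mathcal{O}}))\cap K[S_{c\mathcal{O},\sigma}]$; $G_{\mathcal{O},\sigma}=K[S_{c\mathcal{O},\sigma}]/I(\mathbb{G}_{\mathcal{O},\sigma})$; $U_{\mathcal{O},\sigma}=K[\mathbf{x},S_{c\mathcal{O},\sigma}]/(I(\mathbb{G}_{\mathcal{O},\sigma})+(g_1^*,\dots,g_\eta^* ))$. $\overline{L}_{\mathcal{O},\sigma}$ denotes the ideal generated by the image of $L_{\mathcal{O},\sigma}$ in $B_{\mathcal{O}}$, respectively in $U_{\mathcal{O}}$; thus $B_{\mathcal{O}}/\overline{L}_{\mathcal{O},\sigma}=K[\mathbf{c}]/(L_{\mathcal{O},\sigma}+I(\mathbb{B}_{\mathcal{O}}))$ and $U_{\mathcal{O}}/\overline{L}_{\mathcal{O},\sigma}=K[\mathbf{x},\mathbf{c}]/(L_{\mathcal{O},\sigma}+I(\mathbb{B}_{\mathcal{O}})+(g_1,\dots,g_\nu))$.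 Module structures are via the natural homomorphisms $B_{\mathcal{O}}\to U_{\mathcal{O}}$ and $G_{\mathcal{O},\sigma}\to U_{\mathcal{O},\sigma}$. *)

theory Defs
  imports
    "HOL-Library.Poly_Mapping"
    "HOL-Algebra.QuotRing"
    "HOL-Algebra.Module"
    "Jordan_Normal_Form.Matrix"
begin

section \<open>Polynomial rings\<close>

text \<open>
  All polynomial rings in the development are subrings of one ring of polynomials over the
  field \<open>'k\<close>, in the indeterminates \<open>X k\<close> (the ring variables) and \<open>C i j\<close> (the generic
  coefficients), so the inclusions between them are identity maps.  A term (power product) is its
  exponent function, written additively: the product of terms is \<open>+\<close> and the term 1 is \<open>0\<close>.
  All indices start at 0.
\<close>

datatype indet = X nat | C nat nat

type_synonym pterm = "indet \<Rightarrow>\<^sub>0 nat"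
type_synonym 'k mpoly = "pterm \<Rightarrow>\<^sub>0 'k"

definition var_term :: "indet \<Rightarrow> pterm" where
  "var_term v = Poly_Mapping.single v 1"

definition of_term :: "pterm \<Rightarrow> 'k::field mpoly" where
  "of_term s = Poly_Mapping.single s 1"

definition cvar :: "nat \<Rightarrow> nat \<Rightarrow> 'k::field mpoly" where
  "cvar i j = of_term (var_term (C i j))"

definition poly_ring :: "indet set \<Rightarrow> 'k::field mpoly ring" where
  "poly_ring V = \<lparr>carrier = {p. \<forall>s\<in>Poly_Mapping.keys p. Poly_Mapping.keys s \<subseteq> V},
     monoid.mult = (*), one = 1, zero = 0, add = (+)\<rparr>"

lemma cring_poly_ring: "cring (poly_ring V)"
proof -
  have uminus: "- p \<in> carrier (poly_ring V)" if "p \<in> carrier (poly_ring V)"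
    for p :: "'a mpoly"
    using that by (auto simp: poly_ring_def)
  have add: "p + q \<in> carrier (poly_ring V)"
    if "p \<in> carrier (poly_ring V)" "q \<in> carrier (poly_ring V)" for p q :: "'a mpoly"
    using that keys_add[of p q] by (auto simp: poly_ring_def)
  have mult: "p * q \<in> carrier (poly_ring V)"
    if "p \<in> carrier (poly_ring V)" "q \<in> carrier (poly_ring V)" for p q :: "'a mpoly"
  proof -
    have "Poly_Mapping.keys s \<subseteq> V" if in_keys: "s \<in> Poly_Mapping.keys (p * q)" for s
    proof -
      obtain s1 s2 where s: "s = s1 + s2" and "s1 \<in> Poly_Mapping.keys p" "s2 \<in> Poly_Mapping.keys q"
        using in_keys keys_mult[of p q] by blast
      with \<open>p \<in> _\<close> \<open>q \<in> _\<close> have "Poly_Mapping.keys s1 \<subseteq> V" "Poly_Mapping.keys s2 \<subseteq> V"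
        by (auto simp: poly_ring_def)
      with keys_add[of s1 s2] s show ?thesis by blast
    qed
    then show ?thesis by (simp add: poly_ring_def)
  qed
  have ops: "\<one>\<^bsub>poly_ring V\<^esub> = (1 :: 'a mpoly)" "\<zero>\<^bsub>poly_ring V\<^esub> = (0 :: 'a mpoly)"
    "p \<oplus>\<^bsub>poly_ring V\<^esub> q = p + q" "p \<otimes>\<^bsub>poly_ring V\<^esub> q = p * q" for p q :: "'a mpoly"
    by (simp_all add: poly_ring_def)
  have zero_one: "(0 :: 'a mpoly) \<in> carrier (poly_ring V)" "(1 :: 'a mpoly) \<in> carrier (poly_ring V)"
    by (simp_all add: poly_ring_def)
  show ?thesis
  proof (rule cringI)
    show "abelian_group (poly_ring V :: 'a mpoly ring)"
    proof (rule abelian_groupI)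
      fix p :: "'a mpoly" assume p: "p \<in> carrier (poly_ring V)"
      show "\<exists>q\<in>carrier (poly_ring V). q \<oplus>\<^bsub>poly_ring V\<^esub> p = \<zero>\<^bsub>poly_ring V\<^esub>"
        by (rule bexI[OF _ uminus[OF p]]) (simp add: ops)
    qed (simp_all add: ops zero_one add add.assoc add.commute)
    show "comm_monoid (poly_ring V :: 'a mpoly ring)"
      by (rule comm_monoidI) (simp_all add: ops zero_one mult mult.assoc mult.commute)
  qed (simp add: ops distrib_right)
qed

definition xvars :: "nat \<Rightarrow> indet set" where
  "xvars n = {X k |k. k < n}"

definition cvars :: "nat \<Rightarrow> nat \<Rightarrow> indet set" where
  "cvars \<mu> \<nu> = {C i j |i j. i < \<mu> \<and> j < \<nu>}"

abbreviation Kc :: "nat \<Rightarrow> nat \<Rightarrow> 'k::field mpoly ring" where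
  "Kc \<mu> \<nu> \<equiv> poly_ring (cvars \<mu> \<nu>)"

abbreviation Kxc :: "nat \<Rightarrow> nat \<Rightarrow> nat \<Rightarrow> 'k::field mpoly ring" where
  "Kxc n \<mu> \<nu> \<equiv> poly_ring (xvars n \<union> cvars \<mu> \<nu>)"


section \<open>Terms, order ideals, borders, corners and term orderings\<close>

definition terms :: "nat \<Rightarrow> pterm set" where
  "terms n = {s. Poly_Mapping.keys s \<subseteq> xvars n}"

definition order_ideal :: "nat \<Rightarrow> pterm set \<Rightarrow> bool" where
  "order_ideal n Ord \<longleftrightarrow> Ord \<subseteq> terms n \<and> finite Ord \<and>
     (\<forall>s\<in>terms n. \<forall>u\<in>terms n. s + u \<in> Ord \<longrightarrow> s \<in> Ord)"

definition border :: "nat \<Rightarrow> pterm set \<Rightarrow> pterm set" where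
  "border n Ord = (\<Union>k<n. (\<lambda>s. var_term (X k) + s) ` Ord) - Ord"

definition monoid_ideal :: "nat \<Rightarrow> pterm set \<Rightarrow> pterm set" where
  "monoid_ideal n G = {g + u |g u. g \<in> G \<and> u \<in> terms n}"

definition minimal_generators :: "nat \<Rightarrow> pterm set \<Rightarrow> pterm set \<Rightarrow> bool" where
  "minimal_generators n M G \<longleftrightarrow> monoid_ideal n G = M \<and> (\<forall>H. H \<subset> G \<longrightarrow> monoid_ideal n H \<noteq> M)"

text \<open>The pair \<open>(s, u)\<close> is in \<open>\<sigma>\<close> iff \<open>s \<le>\<^sub>\<sigma> u\<close>.\<close>

definition term_ordering :: "nat \<Rightarrow> pterm rel \<Rightarrow> bool" where
  "term_ordering n \<sigma> \<longleftrightarrow> linear_order_on (terms n) \<sigma> \<and>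
     (\<forall>s\<in>terms n. (0, s) \<in> \<sigma>) \<and>
     (\<forall>s\<in>terms n. \<forall>u\<in>terms n. \<forall>w\<in>terms n. (s, u) \<in> \<sigma> \<longrightarrow> (s + w, u + w) \<in> \<sigma>)"

definition gt_term :: "pterm rel \<Rightarrow> pterm \<Rightarrow> pterm \<Rightarrow> bool" where
  "gt_term \<sigma> s u \<longleftrightarrow> (u, s) \<in> \<sigma> \<and> u \<noteq> s"

text \<open>
  A labelled order ideal: the terms of \<open>Ord\<close> are \<open>t 0, \<dots>, t (\<mu> - 1)\<close>, the terms of its border
  are \<open>b 0, \<dots>, b (\<nu> - 1)\<close>, and the corners are \<open>b 0, \<dots>, b (\<eta> - 1)\<close>.
\<close>

definition labelled_order_ideal ::
  "nat \<Rightarrow> pterm set \<Rightarrow> nat \<Rightarrow> nat \<Rightarrow> nat \<Rightarrow> (nat \<Rightarrow> pterm) \<Rightarrow> (nat \<Rightarrow> pterm) \<Rightarrow> bool" where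
  "labelled_order_ideal n Ord \<mu> \<nu> \<eta> t b \<longleftrightarrow>
     order_ideal n Ord \<and> bij_betw t {..<\<mu>} Ord \<and> bij_betw b {..<\<nu>} (border n Ord) \<and>
     \<eta> \<le> \<nu> \<and> minimal_generators n (terms n - Ord) (b ` {..<\<eta>})"


section \<open>Quotient rings and modules\<close>

text \<open>
  The map from a quotient of \<open>R\<close> to \<open>S Quot J\<close> induced by \<open>h : R \<rightarrow> S\<close>: it sends the class of
  \<open>a\<close> to the class of \<open>h a\<close>.  It is well defined whenever \<open>h\<close> maps the ideal that is factored
  out of \<open>R\<close> into \<open>J\<close>; see the lemma below.
\<close>

definition induced ::
  "('b, 'm) ring_scheme \<Rightarrow> 'b set \<Rightarrow> ('a \<Rightarrow> 'b) \<Rightarrow> 'a set \<Rightarrow> 'b set" where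
  "induced S J h A = the_elem ((\<lambda>a. J +>\<^bsub>S\<^esub> h a) ` A)"

lemma induced_class:
  assumes I: "ideal I R" and J: "ideal J S" and h: "h \<in> Ring.ring_hom R S" and IJ: "h ` I \<subseteq> J"
    and a: "a \<in> carrier R"
  shows "induced S J h (I +>\<^bsub>R\<^esub> a) = J +>\<^bsub>S\<^esub> h a"
proof -
  interpret I: ideal I R by (rule I)
  interpret J: ideal J S by (rule J)
  have "J +>\<^bsub>S\<^esub> h x = J +>\<^bsub>S\<^esub> h a" if x: "x \<in> I +>\<^bsub>R\<^esub> a" for x
  proof -
    from x obtain i where i: "i \<in> I" and xi: "x = i \<oplus>\<^bsub>R\<^esub> a"
      by (auto simp: a_r_coset_def')
    have iR: "i \<in> carrier R" using i by (rule I.a_Hcarr)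
    have "h x = h i \<oplus>\<^bsub>S\<^esub> h a" using ring_hom_add[OF h iR a] xi by simp
    then have "h x \<in> J +>\<^bsub>S\<^esub> h a" using i IJ by (auto simp: a_r_coset_def')
    then show ?thesis
      using J.a_repr_independence' ring_hom_closed[OF h a] by simp
  qed
  moreover have "a \<in> I +>\<^bsub>R\<^esub> a" using a by (rule I.a_rcos_self)
  ultimately have "(\<lambda>a. J +>\<^bsub>S\<^esub> h a) ` (I +>\<^bsub>R\<^esub> a) = {J +>\<^bsub>S\<^esub> h a}" by blast
  then show ?thesis by (simp add: induced_def)
qed

text \<open>The ring \<open>S\<close> as a module via a ring homomorphism \<open>f\<close> into \<open>S\<close>.\<close>

definition module_via :: "('a \<Rightarrow> 'b) \<Rightarrow> 'b ring \<Rightarrow> ('a, 'b) module" where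
  "module_via f S = \<lparr>carrier = carrier S, monoid.mult = monoid.mult S, one = one S,
     zero = zero S, add = add S,
     smult = (\<lambda>a u. f a \<otimes>\<^bsub>S\<^esub> u)\<rparr>"

text \<open>A finite family \<open>v\<close>, indexed by \<open>N\<close>, that is a basis (as a family, so injective unless
  \<open>R\<close> is the zero ring).\<close>

definition module_basis ::
  "('a, 'm) ring_scheme \<Rightarrow> ('a, 'b, 'p) module_scheme \<Rightarrow> 'i set \<Rightarrow> ('i \<Rightarrow> 'b) \<Rightarrow> bool" where
  "module_basis R M N v \<longleftrightarrow> module R M \<and> finite N \<and> v \<in> N \<rightarrow> carrier M \<and>
     (\<forall>u\<in>carrier M. \<exists>a\<in>N \<rightarrow> carrier R. u = (\<Oplus>\<^bsub>M\<^esub>i\<in>N. a i \<odot>\<^bsub>M\<^esub> v i)) \<and>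
     (\<forall>a\<in>N \<rightarrow> carrier R. (\<Oplus>\<^bsub>M\<^esub>i\<in>N. a i \<odot>\<^bsub>M\<^esub> v i) = \<zero>\<^bsub>M\<^esub> \<longrightarrow> (\<forall>i\<in>N. a i = \<zero>\<^bsub>R\<^esub>))"


section \<open>The border basis scheme and its universal family\<close>

definition generic_prebasis ::
  "nat \<Rightarrow> (nat \<Rightarrow> pterm) \<Rightarrow> (nat \<Rightarrow> pterm) \<Rightarrow> nat \<Rightarrow> 'k::field mpoly" where
  "generic_prebasis \<mu> t b j = of_term (b j) - (\<Sum>i<\<mu>. cvar i j * of_term (t i))"

definition generic_mult_mat ::
  "nat \<Rightarrow> nat \<Rightarrow> (nat \<Rightarrow> pterm) \<Rightarrow> (nat \<Rightarrow> pterm) \<Rightarrow> nat \<Rightarrow> 'k::field mpoly mat" where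
  "generic_mult_mat \<mu> \<nu> t b k = mat \<mu> \<mu> (\<lambda>(i, j).
     let s = var_term (X k) + t j in
     if s \<in> t ` {..<\<mu>} then (if s = t i then 1 else 0)
     else cvar i (THE m. m < \<nu> \<and> s = b m))"

definition ideal_B ::
  "nat \<Rightarrow> nat \<Rightarrow> nat \<Rightarrow> (nat \<Rightarrow> pterm) \<Rightarrow> (nat \<Rightarrow> pterm) \<Rightarrow> 'k::field mpoly set" where
  "ideal_B n \<mu> \<nu> t b = Idl\<^bsub>Kc \<mu> \<nu>\<^esub>
     {(generic_mult_mat \<mu> \<nu> t b k * generic_mult_mat \<mu> \<nu> t b l
       - generic_mult_mat \<mu> \<nu> t b l * generic_mult_mat \<mu> \<nu> t b k) $$ (i, j)
      |i j k l. i < \<mu> \<and> j < \<mu> \<and> k < l \<and> l < n}"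

definition ring_B ::
  "nat \<Rightarrow> nat \<Rightarrow> nat \<Rightarrow> (nat \<Rightarrow> pterm) \<Rightarrow> (nat \<Rightarrow> pterm) \<Rightarrow> 'k::field mpoly set ring" where
  "ring_B n \<mu> \<nu> t b = Kc \<mu> \<nu> Quot ideal_B n \<mu> \<nu> t b"

definition ideal_U ::
  "nat \<Rightarrow> nat \<Rightarrow> nat \<Rightarrow> (nat \<Rightarrow> pterm) \<Rightarrow> (nat \<Rightarrow> pterm) \<Rightarrow> 'k::field mpoly set" where
  "ideal_U n \<mu> \<nu> t b = Idl\<^bsub>Kxc n \<mu> \<nu>\<^esub> (ideal_B n \<mu> \<nu> t b \<union> generic_prebasis \<mu> t b ` {..<\<nu>})"

definition ring_U ::
  "nat \<Rightarrow> nat \<Rightarrow> nat \<Rightarrow> (nat \<Rightarrow> pterm) \<Rightarrow> (nat \<Rightarrow> pterm) \<Rightarrow> 'k::field mpoly set ring" where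
  "ring_U n \<mu> \<nu> t b = Kxc n \<mu> \<nu> Quot ideal_U n \<mu> \<nu> t b"

definition class_B ::
  "nat \<Rightarrow> nat \<Rightarrow> nat \<Rightarrow> (nat \<Rightarrow> pterm) \<Rightarrow> (nat \<Rightarrow> pterm) \<Rightarrow> 'k::field mpoly \<Rightarrow> 'k mpoly set" where
  "class_B n \<mu> \<nu> t b p = ideal_B n \<mu> \<nu> t b +>\<^bsub>Kc \<mu> \<nu>\<^esub> p"

definition class_U ::
  "nat \<Rightarrow> nat \<Rightarrow> nat \<Rightarrow> (nat \<Rightarrow> pterm) \<Rightarrow> (nat \<Rightarrow> pterm) \<Rightarrow> 'k::field mpoly \<Rightarrow> 'k mpoly set" where
  "class_U n \<mu> \<nu> t b p = ideal_U n \<mu> \<nu> t b +>\<^bsub>Kxc n \<mu> \<nu>\<^esub> p"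

definition B_to_U ::
  "nat \<Rightarrow> nat \<Rightarrow> nat \<Rightarrow> (nat \<Rightarrow> pterm) \<Rightarrow> (nat \<Rightarrow> pterm) \<Rightarrow> 'k::field mpoly set \<Rightarrow> 'k mpoly set" where
  "B_to_U n \<mu> \<nu> t b = induced (Kxc n \<mu> \<nu>) (ideal_U n \<mu> \<nu> t b) id"


section \<open>The quotients of \<open>B\<close> and \<open>U\<close> by the image of \<open>L\<close>\<close>

definition S_all ::
  "nat \<Rightarrow> nat \<Rightarrow> (nat \<Rightarrow> pterm) \<Rightarrow> (nat \<Rightarrow> pterm) \<Rightarrow> pterm rel \<Rightarrow> indet set" where
  "S_all \<mu> \<nu> t b \<sigma> = {C i j |i j. i < \<mu> \<and> j < \<nu> \<and> gt_term \<sigma> (b j) (t i)}"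

definition ideal_L ::
  "nat \<Rightarrow> nat \<Rightarrow> (nat \<Rightarrow> pterm) \<Rightarrow> (nat \<Rightarrow> pterm) \<Rightarrow> pterm rel \<Rightarrow> 'k::field mpoly set" where
  "ideal_L \<mu> \<nu> t b \<sigma> = Idl\<^bsub>Kc \<mu> \<nu>\<^esub>
     {cvar i j |i j. i < \<mu> \<and> j < \<nu> \<and> C i j \<notin> S_all \<mu> \<nu> t b \<sigma>}"

definition Lbar_B :: "nat \<Rightarrow> nat \<Rightarrow> nat \<Rightarrow> (nat \<Rightarrow> pterm) \<Rightarrow> (nat \<Rightarrow> pterm) \<Rightarrow> pterm rel \<Rightarrow>
    'k::field mpoly set set" where
  "Lbar_B n \<mu> \<nu> t b \<sigma> =
     Idl\<^bsub>ring_B n \<mu> \<nu> t b\<^esub> (class_B n \<mu> \<nu> t b ` ideal_L \<mu> \<nu> t b \<sigma>)"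

definition Lbar_U :: "nat \<Rightarrow> nat \<Rightarrow> nat \<Rightarrow> (nat \<Rightarrow> pterm) \<Rightarrow> (nat \<Rightarrow> pterm) \<Rightarrow> pterm rel \<Rightarrow>
    'k::field mpoly set set" where
  "Lbar_U n \<mu> \<nu> t b \<sigma> =
     Idl\<^bsub>ring_U n \<mu> \<nu> t b\<^esub> (class_U n \<mu> \<nu> t b ` ideal_L \<mu> \<nu> t b \<sigma>)"

definition ring_B_mod_L :: "nat \<Rightarrow> nat \<Rightarrow> nat \<Rightarrow> (nat \<Rightarrow> pterm) \<Rightarrow> (nat \<Rightarrow> pterm) \<Rightarrow> pterm rel \<Rightarrow>
    'k::field mpoly set set ring" where
  "ring_B_mod_L n \<mu> \<nu> t b \<sigma> = ring_B n \<mu> \<nu> t b Quot Lbar_B n \<mu> \<nu> t b \<sigma>"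

definition ring_U_mod_L :: "nat \<Rightarrow> nat \<Rightarrow> nat \<Rightarrow> (nat \<Rightarrow> pterm) \<Rightarrow> (nat \<Rightarrow> pterm) \<Rightarrow> pterm rel \<Rightarrow>
    'k::field mpoly set set ring" where
  "ring_U_mod_L n \<mu> \<nu> t b \<sigma> = ring_U n \<mu> \<nu> t b Quot Lbar_U n \<mu> \<nu> t b \<sigma>"

definition class_B_mod_L :: "nat \<Rightarrow> nat \<Rightarrow> nat \<Rightarrow> (nat \<Rightarrow> pterm) \<Rightarrow> (nat \<Rightarrow> pterm) \<Rightarrow> pterm rel \<Rightarrow>
    'k::field mpoly \<Rightarrow> 'k mpoly set set" where
  "class_B_mod_L n \<mu> \<nu> t b \<sigma> p =
     Lbar_B n \<mu> \<nu> t b \<sigma> +>\<^bsub>ring_B n \<mu> \<nu> t b\<^esub> class_B n \<mu> \<nu> t b p"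

definition class_U_mod_L :: "nat \<Rightarrow> nat \<Rightarrow> nat \<Rightarrow> (nat \<Rightarrow> pterm) \<Rightarrow> (nat \<Rightarrow> pterm) \<Rightarrow> pterm rel \<Rightarrow>
    'k::field mpoly \<Rightarrow> 'k mpoly set set" where
  "class_U_mod_L n \<mu> \<nu> t b \<sigma> p =
     Lbar_U n \<mu> \<nu> t b \<sigma> +>\<^bsub>ring_U n \<mu> \<nu> t b\<^esub> class_U n \<mu> \<nu> t b p"

definition module_U_mod_L :: "nat \<Rightarrow> nat \<Rightarrow> nat \<Rightarrow> (nat \<Rightarrow> pterm) \<Rightarrow> (nat \<Rightarrow> pterm) \<Rightarrow> pterm rel \<Rightarrow>
    ('k::field mpoly set set, 'k mpoly set set) module" where
  "module_U_mod_L n \<mu> \<nu> t b \<sigma> = module_via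
     (induced (ring_U n \<mu> \<nu> t b) (Lbar_U n \<mu> \<nu> t b \<sigma>) (B_to_U n \<mu> \<nu> t b))
     (ring_U_mod_L n \<mu> \<nu> t b \<sigma>)"


section \<open>The Groebner basis scheme and its universal family\<close>

definition S_corner ::
  "nat \<Rightarrow> nat \<Rightarrow> nat \<Rightarrow> (nat \<Rightarrow> pterm) \<Rightarrow> (nat \<Rightarrow> pterm) \<Rightarrow> pterm rel \<Rightarrow> indet set" where
  "S_corner \<mu> \<nu> \<eta> t b \<sigma> = {C i j |i j. C i j \<in> S_all \<mu> \<nu> t b \<sigma> \<and> j < \<eta>}"

abbreviation KS :: "nat \<Rightarrow> nat \<Rightarrow> nat \<Rightarrow> (nat \<Rightarrow> pterm) \<Rightarrow> (nat \<Rightarrow> pterm) \<Rightarrow> pterm rel \<Rightarrow>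
    'k::field mpoly ring" where
  "KS \<mu> \<nu> \<eta> t b \<sigma> \<equiv> poly_ring (S_corner \<mu> \<nu> \<eta> t b \<sigma>)"

abbreviation KxS :: "nat \<Rightarrow> nat \<Rightarrow> nat \<Rightarrow> nat \<Rightarrow> (nat \<Rightarrow> pterm) \<Rightarrow> (nat \<Rightarrow> pterm) \<Rightarrow> pterm rel \<Rightarrow>
    'k::field mpoly ring" where
  "KxS n \<mu> \<nu> \<eta> t b \<sigma> \<equiv> poly_ring (xvars n \<union> S_corner \<mu> \<nu> \<eta> t b \<sigma>)"

definition generic_prebasis_star ::
  "nat \<Rightarrow> (nat \<Rightarrow> pterm) \<Rightarrow> (nat \<Rightarrow> pterm) \<Rightarrow> pterm rel \<Rightarrow> nat \<Rightarrow> 'k::field mpoly" where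
  "generic_prebasis_star \<mu> t b \<sigma> j =
     of_term (b j) - (\<Sum>i | i < \<mu> \<and> gt_term \<sigma> (b j) (t i). cvar i j * of_term (t i))"

definition ideal_G :: "nat \<Rightarrow> nat \<Rightarrow> nat \<Rightarrow> nat \<Rightarrow> (nat \<Rightarrow> pterm) \<Rightarrow> (nat \<Rightarrow> pterm) \<Rightarrow> pterm rel \<Rightarrow>
    'k::field mpoly set" where
  "ideal_G n \<mu> \<nu> \<eta> t b \<sigma> =
     (ideal_L \<mu> \<nu> t b \<sigma> <+>\<^bsub>Kc \<mu> \<nu>\<^esub> ideal_B n \<mu> \<nu> t b) \<inter> carrier (KS \<mu> \<nu> \<eta> t b \<sigma>)"

definition ring_G :: "nat \<Rightarrow> nat \<Rightarrow> nat \<Rightarrow> nat \<Rightarrow> (nat \<Rightarrow> pterm) \<Rightarrow> (nat \<Rightarrow> pterm) \<Rightarrow> pterm rel \<Rightarrow>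
    'k::field mpoly set ring" where
  "ring_G n \<mu> \<nu> \<eta> t b \<sigma> = KS \<mu> \<nu> \<eta> t b \<sigma> Quot ideal_G n \<mu> \<nu> \<eta> t b \<sigma>"

definition ideal_UG :: "nat \<Rightarrow> nat \<Rightarrow> nat \<Rightarrow> nat \<Rightarrow> (nat \<Rightarrow> pterm) \<Rightarrow> (nat \<Rightarrow> pterm) \<Rightarrow> pterm rel \<Rightarrow>
    'k::field mpoly set" where
  "ideal_UG n \<mu> \<nu> \<eta> t b \<sigma> = Idl\<^bsub>KxS n \<mu> \<nu> \<eta> t b \<sigma>\<^esub>
     (ideal_G n \<mu> \<nu> \<eta> t b \<sigma> \<union> generic_prebasis_star \<mu> t b \<sigma> ` {..<\<eta>})"

definition ring_UG :: "nat \<Rightarrow> nat \<Rightarrow> nat \<Rightarrow> nat \<Rightarrow> (nat \<Rightarrow> pterm) \<Rightarrow> (nat \<Rightarrow> pterm) \<Rightarrow> pterm rel \<Rightarrow>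
    'k::field mpoly set ring" where
  "ring_UG n \<mu> \<nu> \<eta> t b \<sigma> = KxS n \<mu> \<nu> \<eta> t b \<sigma> Quot ideal_UG n \<mu> \<nu> \<eta> t b \<sigma>"

definition class_UG :: "nat \<Rightarrow> nat \<Rightarrow> nat \<Rightarrow> nat \<Rightarrow> (nat \<Rightarrow> pterm) \<Rightarrow> (nat \<Rightarrow> pterm) \<Rightarrow> pterm rel \<Rightarrow>
    'k::field mpoly \<Rightarrow> 'k mpoly set" where
  "class_UG n \<mu> \<nu> \<eta> t b \<sigma> p =
     ideal_UG n \<mu> \<nu> \<eta> t b \<sigma> +>\<^bsub>KxS n \<mu> \<nu> \<eta> t b \<sigma>\<^esub> p"

definition module_UG :: "nat \<Rightarrow> nat \<Rightarrow> nat \<Rightarrow> nat \<Rightarrow> (nat \<Rightarrow> pterm) \<Rightarrow> (nat \<Rightarrow> pterm) \<Rightarrow> pterm rel \<Rightarrow>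
    ('k::field mpoly set, 'k mpoly set) module" where
  "module_UG n \<mu> \<nu> \<eta> t b \<sigma> = module_via
     (induced (KxS n \<mu> \<nu> \<eta> t b \<sigma>) (ideal_UG n \<mu> \<nu> \<eta> t b \<sigma>) id)
     (ring_UG n \<mu> \<nu> \<eta> t b \<sigma>)"


section \<open>The canonical homomorphisms\<close>

definition Theta :: "'k::field mpoly \<Rightarrow> 'k mpoly" where
  "Theta p = p"

definition phi :: "nat \<Rightarrow> nat \<Rightarrow> nat \<Rightarrow> (nat \<Rightarrow> pterm) \<Rightarrow> (nat \<Rightarrow> pterm) \<Rightarrow> pterm rel \<Rightarrow>
    'k::field mpoly set \<Rightarrow> 'k mpoly set set" where
  "phi n \<mu> \<nu> t b \<sigma> =
     induced (ring_B n \<mu> \<nu> t b) (Lbar_B n \<mu> \<nu> t b \<sigma>) (class_B n \<mu> \<nu> t b)"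

definition vartheta :: "nat \<Rightarrow> nat \<Rightarrow> nat \<Rightarrow> (nat \<Rightarrow> pterm) \<Rightarrow> (nat \<Rightarrow> pterm) \<Rightarrow> pterm rel \<Rightarrow>
    'k::field mpoly set \<Rightarrow> 'k mpoly set set" where
  "vartheta n \<mu> \<nu> t b \<sigma> =
     induced (ring_U n \<mu> \<nu> t b) (Lbar_U n \<mu> \<nu> t b \<sigma>) (class_U n \<mu> \<nu> t b \<circ> Theta)"

end

theory Submission
  imports Defs
begin

text \<open>
  The universal family over the border basis scheme is free with basis \<open>Ord\<close>.  This survives
  reduction modulo \<open>L\<close>, and after that reduction the coefficients of the corners determine all the
  others; this is why the Groebner basis scheme is the locus \<open>L = 0\<close> in the border basis scheme.
  Write \<open>J\<close> for the ideal \<open>L + I(B)\<close> of \<open>K[c]\<close> and \<open>W\<close>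
  for the ideal of \<open>K[x, c]\<close> generated by \<open>L\<close>, \<open>I(B)\<close> and the generic prebasis.

  Spanning modulo \<open>W\<close> is easy: multiplying an element of \<open>Ord\<close> by an indeterminate leads into \<open>Ord\<close>
  or into the border, and the prebasis rewrites the border (\<open>Ord_spans\<close>).  For independence, let
  \<open>X k\<close> act on column vectors by the \<open>k\<close>-th generic multiplication matrix.  Modulo any ideal that
  contains \<open>I(B)\<close>, such as \<open>J\<close>, these matrices commute, so a polynomial can be applied to the unit vector that
  belongs to the term 1.  The result, \<open>coords\<close>, is a coordinate vector modulo \<open>J\<close>: it sends the
  terms of \<open>Ord\<close> to the unit vectors and the prebasis and \<open>J\<close> to 0, hence kills \<open>W\<close>
  (\<open>Ord_independent\<close>).

  The second ingredient is an induction along \<open>\<sigma>\<close> over the finite border.  A border term that is not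
  a corner has the form \<open>b j = X k * b m\<close>, and one column of a commutator says that, modulo \<open>I(B)\<close>,
  column \<open>j\<close> of the coefficients is the \<open>k\<close>-th matrix applied to column \<open>m\<close>
  (\<open>noncorner_relation\<close>).  Modulo \<open>L\<close> only coefficients that belong to border terms smaller than
  \<open>b j\<close> occur there, so every \<open>cvar i j\<close> is congruent to a polynomial in the corner coefficients
  (\<open>Kc_eliminable\<close>).  The same induction shows that the corner polynomials \<open>g*\<close> alone
  already rewrite each border term by smaller elements of \<open>Ord\<close> (\<open>border_below\<close>).  So \<open>Ord\<close> spans modulo
  \<open>ideal_UG\<close>, with coefficients in the corner indeterminates.

  The theorem follows.  If a polynomial of \<open>K[x, S]\<close> lies in \<open>W\<close>, its expansion
  modulo \<open>ideal_UG\<close> is a combination of \<open>Ord\<close> in \<open>W\<close>, so its coefficients lie in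
  \<open>J \<inter> K[S] = ideal_G\<close>; therefore it lies in \<open>ideal_UG\<close>.  This gives (c), the independence in (b) and the
  injectivity of \<open>\<vartheta>\<close>; (a) is spanning and independence modulo \<open>W\<close>.  The injectivity of \<open>\<phi>\<close>
  is the definition of \<open>ideal_G\<close>, and both surjectivities come from the elimination.
\<close>

section \<open>Polynomials\<close>

lemma poly_ring_ops [simp]:
  "\<one>\<^bsub>poly_ring V\<^esub> = 1" "\<zero>\<^bsub>poly_ring V\<^esub> = 0"
  "p \<oplus>\<^bsub>poly_ring V\<^esub> q = p + q" "p \<otimes>\<^bsub>poly_ring V\<^esub> q = p * q"
  by (simp_all add: poly_ring_def)

lemma ring_poly_ring: "ring (poly_ring V)"
  using cring_poly_ring cring.axioms(1) by blast

lemma in_poly_ring_iff: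
  "p \<in> carrier (poly_ring V) \<longleftrightarrow> (\<forall>s\<in>Poly_Mapping.keys p. Poly_Mapping.keys s \<subseteq> V)"
  by (simp add: poly_ring_def)

lemma poly_ring_mono: "V \<subseteq> V' \<Longrightarrow> carrier (poly_ring V) \<subseteq> carrier (poly_ring V')"
  unfolding in_poly_ring_iff subset_iff by blast

lemma poly_ring_zero [simp, intro]: "0 \<in> carrier (poly_ring V)"
  by (simp add: in_poly_ring_iff)

lemma poly_ring_one [simp, intro]: "1 \<in> carrier (poly_ring V)"
  by (simp add: in_poly_ring_iff)

lemma poly_ring_add [simp, intro]:
  "p \<in> carrier (poly_ring V) \<Longrightarrow> q \<in> carrier (poly_ring V) \<Longrightarrow> p + q \<in> carrier (poly_ring V)"
  using ring.ring_simprules(1)[OF ring_poly_ring, of p V q] by simp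

lemma poly_ring_mult [simp, intro]:
  "p \<in> carrier (poly_ring V) \<Longrightarrow> q \<in> carrier (poly_ring V) \<Longrightarrow> p * q \<in> carrier (poly_ring V)"
  using ring.ring_simprules(5)[OF ring_poly_ring, of p V q] by simp

lemma poly_ring_uminus [simp, intro]:
  "p \<in> carrier (poly_ring V) \<Longrightarrow> - p \<in> carrier (poly_ring V)"
  by (simp add: in_poly_ring_iff)

lemma poly_ring_diff [simp, intro]:
  "p \<in> carrier (poly_ring V) \<Longrightarrow> q \<in> carrier (poly_ring V) \<Longrightarrow> p - q \<in> carrier (poly_ring V)"
  using poly_ring_add[of p V "- q"] by simp

lemma poly_ring_sum [intro]:
  "(\<And>i. i \<in> A \<Longrightarrow> f i \<in> carrier (poly_ring V)) \<Longrightarrow> sum f A \<in> carrier (poly_ring V)"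
  by (induction A rule: infinite_finite_induct) auto

lemma poly_ring_const [simp, intro]: "Poly_Mapping.single 0 c \<in> carrier (poly_ring V)"
  by (simp add: in_poly_ring_iff)

lemma poly_ring_of_term [intro]:
  "Poly_Mapping.keys s \<subseteq> V \<Longrightarrow> of_term s \<in> carrier (poly_ring V)"
  by (simp add: in_poly_ring_iff of_term_def)

lemma keys_var_term [simp]: "Poly_Mapping.keys (var_term v) = {v}"
  by (simp add: var_term_def)

lemma keys_add_term: "Poly_Mapping.keys (s + u :: pterm) = Poly_Mapping.keys s \<union> Poly_Mapping.keys u"
  by (auto simp: in_keys_iff lookup_add)

lemma poly_ring_var [intro]: "v \<in> V \<Longrightarrow> of_term (var_term v) \<in> carrier (poly_ring V)"
  by (rule poly_ring_of_term) simp

lemma of_term_zero: "of_term 0 = 1"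
  by (simp add: of_term_def)

lemma of_term_add: "of_term (s + u) = of_term s * of_term u"
  by (simp add: of_term_def mult_single)

lemma lookup_var_term: "Poly_Mapping.lookup (var_term v) w = (if v = w then 1 else 0)"
  by (simp add: var_term_def lookup_single when_def)

lemma term_split_var:
  assumes "v \<in> Poly_Mapping.keys (s :: pterm)"
  shows "s = var_term v + (s - var_term v)"
  using assms by (intro poly_mapping_eqI) (auto simp: lookup_add lookup_minus lookup_var_term in_keys_iff)

lemma term_induct [consumes 1, case_names zero var]:
  fixes s :: pterm
  assumes "Poly_Mapping.keys s \<subseteq> V"
    and zero: "P 0"
    and var: "\<And>v s. v \<in> V \<Longrightarrow> Poly_Mapping.keys s \<subseteq> V \<Longrightarrow> P s \<Longrightarrow> P (var_term v + s)"
  shows "P s"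
proof -
  define F where "F = Poly_Mapping.keys s"
  have fin: "finite F" by (simp add: F_def)
  have "P u" if "Poly_Mapping.keys u \<subseteq> F" "Poly_Mapping.keys u \<subseteq> V"
      "sum (Poly_Mapping.lookup u) F = N" for u N
    using that
  proof (induction N arbitrary: u rule: less_induct)
    case (less N)
    show ?case
    proof (cases "u = 0")
      case False
      then obtain v where v: "v \<in> Poly_Mapping.keys u"
        by (metis all_not_in_conv keys_eq_empty)
      define w where "w = u - var_term v"
      have u: "u = var_term v + w" unfolding w_def by (rule term_split_var[OF v])
      have w: "Poly_Mapping.keys w \<subseteq> F" "Poly_Mapping.keys w \<subseteq> V"
        using less.prems(1,2) keys_add_term[of "var_term v" w] u by auto
      have "v \<in> F" "v \<in> V" using v less.prems by auto
      have "sum (Poly_Mapping.lookup u) F = sum (Poly_Mapping.lookup w) F + 1"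
        unfolding u using fin \<open>v \<in> F\<close> by (simp add: lookup_add sum.distrib lookup_var_term)
      then have "sum (Poly_Mapping.lookup w) F < N" using less.prems(3) by linarith
      then have "P w" using less.IH w by blast
      then show ?thesis unfolding u by (intro var \<open>v \<in> V\<close> w)
    qed (simp add: zero)
  qed
  then show ?thesis using assms(1) by (simp add: F_def)
qed

lemma sum_monomials:
  "(\<Sum>s\<in>Poly_Mapping.keys p. Poly_Mapping.single s (Poly_Mapping.lookup p s)) = p"
  by (rule poly_mapping_eqI)
    (simp add: lookup_sum lookup_single when_def not_in_keys_iff_lookup_eq_zero)

lemma poly_ring_monomial_induct [consumes 1, case_names monomial add]:
  assumes p: "p \<in> carrier (poly_ring V)"
    and mon: "\<And>s c. Poly_Mapping.keys s \<subseteq> V \<Longrightarrow> P (Poly_Mapping.single s c)"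
    and add: "\<And>p q. p \<in> carrier (poly_ring V) \<Longrightarrow> q \<in> carrier (poly_ring V) \<Longrightarrow> P p \<Longrightarrow> P q \<Longrightarrow> P (p + q)"
  shows "P p"
proof -
  define f where "f s = Poly_Mapping.single s (Poly_Mapping.lookup p s)" for s
  have "P (sum f A) \<and> sum f A \<in> carrier (poly_ring V)"
    if "finite A" "A \<subseteq> Poly_Mapping.keys p" for A
    using that
  proof (induction A rule: finite_induct)
    case empty
    show ?case using mon[of 0 0] by simp
  next
    case (insert s A)
    have s: "Poly_Mapping.keys s \<subseteq> V" using insert.prems p by (auto simp: in_poly_ring_iff)
    then have "f s \<in> carrier (poly_ring V)" by (simp add: f_def in_poly_ring_iff)
    then show ?case using insert add[of "f s" "sum f A"] mon[OF s] by (simp add: f_def)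
  qed
  moreover have "sum f (Poly_Mapping.keys p) = p"
    unfolding f_def by (rule sum_monomials)
  ultimately show ?thesis by (metis finite_keys order_refl)
qed

text \<open>
  This is the form in which ideals and spans are handled below: a condition that survives sums and
  multiplication by single indeterminates needs no bookkeeping of monomials.
\<close>

lemma poly_ring_induct [consumes 1, case_names const add var]:
  fixes p :: "'k::field mpoly"
  assumes p: "p \<in> carrier (poly_ring V)"
    and const: "\<And>c. P (Poly_Mapping.single 0 c)"
    and add: "\<And>p q. p \<in> carrier (poly_ring V) \<Longrightarrow> q \<in> carrier (poly_ring V) \<Longrightarrow> P p \<Longrightarrow> P q \<Longrightarrow> P (p + q)"
    and var: "\<And>v p. v \<in> V \<Longrightarrow> p \<in> carrier (poly_ring V) \<Longrightarrow> P p \<Longrightarrow> P (of_term (var_term v) * p)"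
  shows "P p"
  using p
proof (induction rule: poly_ring_monomial_induct)
  case (monomial s c)
  then show ?case
  proof (induction rule: term_induct)
    case zero
    show ?case by (rule const)
  next
    case (var v s)
    have "Poly_Mapping.single s c \<in> carrier (poly_ring V)"
      using var by (simp add: in_poly_ring_iff)
    then show ?case using assms(4)[of v "Poly_Mapping.single s c"] var
      by (simp add: of_term_def mult_single)
  qed
qed (rule add)


section \<open>Ideals of polynomial rings\<close>

lemma ideal_poly_ringI:
  fixes I :: "'k::field mpoly set"
  assumes "I \<subseteq> carrier (poly_ring V)" "0 \<in> I"
    and add: "\<And>x y. x \<in> I \<Longrightarrow> y \<in> I \<Longrightarrow> x + y \<in> I"
    and mult: "\<And>r x. r \<in> carrier (poly_ring V) \<Longrightarrow> x \<in> I \<Longrightarrow> r * x \<in> I"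
  shows "ideal I (poly_ring V)"
proof (rule idealI[OF ring_poly_ring])
  interpret R: cring "poly_ring V" by (rule cring_poly_ring)
  show "subgroup I (add_monoid (poly_ring V))"
  proof (rule group.subgroupI)
    show "group (add_monoid (poly_ring V))" by (rule R.add.is_group)
    show "I \<subseteq> carrier (add_monoid (poly_ring V))" using assms by simp
    show "I \<noteq> {}" using assms by auto
  next
    fix a assume a: "a \<in> I"
    then have aR: "a \<in> carrier (poly_ring V)" using assms by auto
    have "a \<oplus>\<^bsub>poly_ring V\<^esub> (- a) = \<zero>\<^bsub>poly_ring V\<^esub>" by simp
    then have "\<ominus>\<^bsub>poly_ring V\<^esub> a = - a"
      by (metis R.minus_equality add.commute poly_ring_ops(3) aR poly_ring_uminus)
    also have "- a = (- 1) * a" by simp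
    also have "\<dots> \<in> I" using mult[of "- 1" a] a by blast
    finally show "inv\<^bsub>add_monoid (poly_ring V)\<^esub> a \<in> I" by (simp add: a_inv_def)
  next
    fix a c assume "a \<in> I" "c \<in> I"
    then show "a \<otimes>\<^bsub>add_monoid (poly_ring V)\<^esub> c \<in> I" using add by simp
  qed
next
  fix a x :: "'k mpoly" assume "a \<in> I" "x \<in> carrier (poly_ring V)"
  then have "x * a \<in> I" by (rule mult[rotated])
  then show "x \<otimes>\<^bsub>poly_ring V\<^esub> a \<in> I" "a \<otimes>\<^bsub>poly_ring V\<^esub> x \<in> I"
    by (simp_all add: mult.commute)
qed

context
  fixes I V
  assumes I: "ideal I (poly_ring V)"
begin

lemma ideal_poly_subset: "I \<subseteq> carrier (poly_ring V)"
  using additive_subgroup.a_subset[OF ideal.axioms(1)[OF I]] .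

lemma ideal_poly_zero: "0 \<in> I"
  using additive_subgroup.zero_closed[OF ideal.axioms(1)[OF I]] by simp

lemma ideal_poly_add: "x \<in> I \<Longrightarrow> y \<in> I \<Longrightarrow> x + y \<in> I"
  using additive_subgroup.a_closed[OF ideal.axioms(1)[OF I], of x y] by simp

lemma ideal_poly_mult: "r \<in> carrier (poly_ring V) \<Longrightarrow> x \<in> I \<Longrightarrow> r * x \<in> I"
  using ideal.I_l_closed[OF I, of x r] by simp

lemma ideal_poly_uminus: "x \<in> I \<Longrightarrow> - x \<in> I"
  using ideal_poly_mult[of "- 1" x] by (simp add: poly_ring_uminus)

lemma ideal_poly_diff: "x \<in> I \<Longrightarrow> y \<in> I \<Longrightarrow> x - y \<in> I"
  using ideal_poly_add[of x "- y"] ideal_poly_uminus by simp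

lemma ideal_poly_sum: "(\<And>i. i \<in> A \<Longrightarrow> f i \<in> I) \<Longrightarrow> sum f A \<in> I"
  by (induction A rule: infinite_finite_induct) (auto simp: ideal_poly_zero ideal_poly_add)

lemma ideal_poly_trans: "x - y \<in> I \<Longrightarrow> y - z \<in> I \<Longrightarrow> x - z \<in> I"
  using ideal_poly_add[of "x - y" "y - z"] by simp

lemma ideal_poly_sym: "x - y \<in> I \<Longrightarrow> y - x \<in> I"
  using ideal_poly_uminus[of "x - y"] by simp

end

lemma ideal_poly_contract:
  fixes I :: "'k::field mpoly set"
  assumes I: "ideal I (poly_ring V')" and V: "V \<subseteq> V'"
  shows "ideal (I \<inter> carrier (poly_ring V)) (poly_ring V)"
proof (rule ideal_poly_ringI)
  fix r x :: "'k mpoly"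
  assume "r \<in> carrier (poly_ring V)" "x \<in> I \<inter> carrier (poly_ring V)"
  then show "r * x \<in> I \<inter> carrier (poly_ring V)"
    using ideal_poly_mult[OF I subsetD[OF poly_ring_mono[OF V]]] by blast
qed (use ideal_poly_zero[OF I] ideal_poly_add[OF I] in auto)

lemma a_minus_poly_ring:
  assumes "p \<in> carrier (poly_ring V)" "q \<in> carrier (poly_ring V)"
  shows "p \<ominus>\<^bsub>poly_ring V\<^esub> q = p - q"
proof -
  interpret R: cring "poly_ring V" by (rule cring_poly_ring)
  have "\<ominus>\<^bsub>poly_ring V\<^esub> q = - q"
    by (rule R.minus_equality) (use assms in auto)
  then show ?thesis by (simp add: a_minus_def)
qed

lemmas poly_genideal = ring.genideal_ideal[OF ring_poly_ring]
lemmas poly_genideal_self = ring.genideal_self[OF ring_poly_ring]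
lemmas poly_genideal_minimal = ring.genideal_minimal[OF ring_poly_ring]

section \<open>Presented rings and modules\<close>

text \<open>
  All rings in the theorem are quotients of polynomial rings, some of them iterated.  A
  presentation hides the shape of their elements (sets of polynomials, or sets of such sets), so that
  claims about homomorphisms and bases become claims about membership of polynomials in ideals.
\<close>

definition presents where
  "presents V I h S \<longleftrightarrow> cring S \<and> h \<in> Ring.ring_hom (poly_ring V) S \<and>
     h ` carrier (poly_ring V) = carrier S \<and>
     I \<subseteq> carrier (poly_ring V) \<and> (\<forall>p\<in>carrier (poly_ring V). h p = \<zero>\<^bsub>S\<^esub> \<longleftrightarrow> p \<in> I)"

lemma presentsD:
  assumes "presents V I h S"
  shows "cring S" "h \<in> Ring.ring_hom (poly_ring V) S" "ring_hom_ring (poly_ring V) S h"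
    "h ` carrier (poly_ring V) = carrier S"
    "\<And>p. p \<in> carrier (poly_ring V) \<Longrightarrow> h p \<in> carrier S"
    "\<And>p q. p \<in> carrier (poly_ring V) \<Longrightarrow> q \<in> carrier (poly_ring V) \<Longrightarrow> h (p + q) = h p \<oplus>\<^bsub>S\<^esub> h q"
    "\<And>p q. p \<in> carrier (poly_ring V) \<Longrightarrow> q \<in> carrier (poly_ring V) \<Longrightarrow> h (p * q) = h p \<otimes>\<^bsub>S\<^esub> h q"
    "h 0 = \<zero>\<^bsub>S\<^esub>" "h 1 = \<one>\<^bsub>S\<^esub>"
    "\<And>p. p \<in> carrier (poly_ring V) \<Longrightarrow> h p = \<zero>\<^bsub>S\<^esub> \<longleftrightarrow> p \<in> I"
proof -
  interpret R: cring "poly_ring V" by (rule cring_poly_ring)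
  show S: "cring S" and h: "h \<in> Ring.ring_hom (poly_ring V) S"
    and "h ` carrier (poly_ring V) = carrier S"
    and "\<And>p. p \<in> carrier (poly_ring V) \<Longrightarrow> h p = \<zero>\<^bsub>S\<^esub> \<longleftrightarrow> p \<in> I"
    using assms by (auto simp: presents_def)
  interpret S: cring S by (rule S)
  show hh: "ring_hom_ring (poly_ring V) S h"
    by (rule ring_hom_ringI2[OF R.ring_axioms S.ring_axioms h])
  show "\<And>p. p \<in> carrier (poly_ring V) \<Longrightarrow> h p \<in> carrier S"
    using ring_hom_closed[OF h] by blast
  show "\<And>p q. p \<in> carrier (poly_ring V) \<Longrightarrow> q \<in> carrier (poly_ring V) \<Longrightarrow> h (p + q) = h p \<oplus>\<^bsub>S\<^esub> h q"
    using ring_hom_add[OF h] by simp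
  show "\<And>p q. p \<in> carrier (poly_ring V) \<Longrightarrow> q \<in> carrier (poly_ring V) \<Longrightarrow> h (p * q) = h p \<otimes>\<^bsub>S\<^esub> h q"
    using ring_hom_mult[OF h] by simp
  show "h 1 = \<one>\<^bsub>S\<^esub>" using ring_hom_one[OF h] by simp
  show "h 0 = \<zero>\<^bsub>S\<^esub>" using ring_hom_zero[OF h R.ring_axioms S.ring_axioms] by simp
qed

lemma presents_surj:
  assumes "presents V I h S" "x \<in> carrier S"
  shows "\<exists>p\<in>carrier (poly_ring V). x = h p"
  using assms(2) unfolding presentsD(4)[OF assms(1), symmetric] by (rule imageE) (rule bexI)

lemma presents_eq_iff:
  assumes pr: "presents V I h S" and p: "p \<in> carrier (poly_ring V)" and q: "q \<in> carrier (poly_ring V)"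
  shows "h p = h q \<longleftrightarrow> p - q \<in> I"
proof -
  interpret S: cring S by (rule presentsD(1)[OF pr])
  have "h p = h (p - q) \<oplus>\<^bsub>S\<^esub> h q"
    using presentsD(6)[OF pr, of "p - q" q] p q by (simp add: poly_ring_diff)
  moreover have "h (p - q) \<in> carrier S" "h q \<in> carrier S"
    using presentsD(5)[OF pr] p q by auto
  ultimately have "h p = h q \<longleftrightarrow> h (p - q) = \<zero>\<^bsub>S\<^esub>"
    by (metis S.add.r_cancel_one)
  then show ?thesis using presentsD(10)[OF pr] p q by auto
qed

lemma presents_quot:
  fixes I :: "'k::field mpoly set"
  assumes "ideal I (poly_ring V)"
  shows "presents V I (\<lambda>p. I +>\<^bsub>poly_ring V\<^esub> p) (poly_ring V Quot I)"
  unfolding presents_def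
proof (intro conjI ballI)
  interpret R: cring "poly_ring V" by (rule cring_poly_ring)
  interpret I: ideal I "poly_ring V" by (rule assms)
  show "cring (poly_ring V Quot I)" by (rule I.quotient_is_cring[OF cring_poly_ring])
  show "(+>\<^bsub>poly_ring V\<^esub>) I \<in> Ring.ring_hom (poly_ring V) (poly_ring V Quot I)"
    by (rule I.rcos_ring_hom)
  show "(+>\<^bsub>poly_ring V\<^esub>) I ` carrier (poly_ring V) = carrier (poly_ring V Quot I)"
    by (auto simp: FactRing_def A_RCOSETS_def')
  show "I \<subseteq> carrier (poly_ring V)" by (rule I.a_subset)
  fix p :: "'k mpoly" assume p: "p \<in> carrier (poly_ring V)"
  show "(I +>\<^bsub>poly_ring V\<^esub> p = \<zero>\<^bsub>poly_ring V Quot I\<^esub>) \<longleftrightarrow> p \<in> I"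
    using R.quotient_eq_iff_same_a_r_cos[OF assms p, of "0"] R.a_rcos_zero[OF assms, of 0]
      ideal_poly_zero[OF assms] p a_minus_poly_ring[of p V 0]
    by (simp add: FactRing_def)
qed

text \<open>
  Third isomorphism theorem: dividing a presented ring by the ideal generated by the classes of \<open>G\<close>
  amounts to adding \<open>G\<close> to the relations.  The image of an ideal under the surjection \<open>h\<close> is again
  an ideal, so nothing outside \<open>Idl (I \<union> G)\<close> is mapped into \<open>J\<close>.
\<close>

lemma presents_quot_genideal:
  fixes I :: "'k::field mpoly set"
  assumes pr: "presents V I h S" and I: "ideal I (poly_ring V)"
    and G: "G \<subseteq> carrier (poly_ring V)"
  defines "J \<equiv> Idl\<^bsub>S\<^esub> (h ` G)"
  shows "presents V (Idl\<^bsub>poly_ring V\<^esub> (I \<union> G)) (\<lambda>p. J +>\<^bsub>S\<^esub> h p) (S Quot J)"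
    and "ideal J S"
proof -
  interpret R: cring "poly_ring V" by (rule cring_poly_ring)
  interpret S: cring S by (rule presentsD(1)[OF pr])
  interpret h: ring_hom_ring "poly_ring V" S h by (rule presentsD(3)[OF pr])
  have IR: "I \<subseteq> carrier (poly_ring V)" by (rule ideal_poly_subset[OF I])
  define W where "W = Idl\<^bsub>poly_ring V\<^esub> (I \<union> G)"
  have W: "ideal W (poly_ring V)" unfolding W_def using IR G by (intro poly_genideal) auto
  have IW: "I \<union> G \<subseteq> W" unfolding W_def using IR G by (intro poly_genideal_self) auto
  have hG: "h ` G \<subseteq> carrier S" using G by auto
  show J: "ideal J S" unfolding J_def by (rule S.genideal_ideal[OF hG])
  have GJ: "h ` G \<subseteq> J" unfolding J_def by (rule S.genideal_self[OF hG])
  interpret J: ideal J S by (rule J)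
  have WJ: "h p \<in> J \<longleftrightarrow> p \<in> W" if p: "p \<in> carrier (poly_ring V)" for p
  proof
    have "W \<subseteq> {p \<in> carrier (poly_ring V). h p \<in> J}"
      unfolding W_def
    proof (rule poly_genideal_minimal)
      show "ideal {p \<in> carrier (poly_ring V). h p \<in> J} (poly_ring V)" by (rule h.ideal_vimage[OF J])
      have "h p \<in> J" if p: "p \<in> I" for p
        using presentsD(10)[OF pr subsetD[OF IR p]] p J.zero_closed by metis
      then show "I \<union> G \<subseteq> {p \<in> carrier (poly_ring V). h p \<in> J}" using GJ IR G by blast
    qed
    then show "p \<in> W \<Longrightarrow> h p \<in> J" by auto
  next
    assume hp: "h p \<in> J"
    have "ideal (h ` W) S"
    proof (rule idealI[OF S.ring_axioms])
      show "subgroup (h ` W) (add_monoid S)"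
      proof (rule group.subgroupI[OF S.add.is_group])
        show "h ` W \<subseteq> carrier (add_monoid S)" using ideal_poly_subset[OF W] by auto
        show "h ` W \<noteq> {}" using ideal_poly_zero[OF W] by auto
      next
        fix a assume "a \<in> h ` W"
        then obtain w where w: "w \<in> W" "a = h w" by auto
        have wR: "w \<in> carrier (poly_ring V)" using w ideal_poly_subset[OF W] by auto
        have "\<ominus>\<^bsub>S\<^esub> a = h (- w)"
        proof (rule S.minus_equality)
          show "h (- w) \<oplus>\<^bsub>S\<^esub> a = \<zero>\<^bsub>S\<^esub>"
            using presentsD(6)[OF pr poly_ring_uminus[OF wR] wR] presentsD(8)[OF pr]
            by (simp add: w(2))
          show "a \<in> carrier S" unfolding w(2) by (rule presentsD(5)[OF pr wR])
          show "h (- w) \<in> carrier S" by (rule presentsD(5)[OF pr poly_ring_uminus[OF wR]])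
        qed
        moreover have "- w \<in> W" by (rule ideal_poly_uminus[OF W w(1)])
        ultimately show "inv\<^bsub>add_monoid S\<^esub> a \<in> h ` W" unfolding a_inv_def by blast
      next
        fix a c assume "a \<in> h ` W" "c \<in> h ` W"
        then obtain x y where xy: "x \<in> W" "a = h x" "y \<in> W" "c = h y" by auto
        have "h (x + y) = a \<oplus>\<^bsub>S\<^esub> c"
          unfolding xy by (intro presentsD(6)[OF pr] subsetD[OF ideal_poly_subset[OF W]] xy)
        then have "a \<oplus>\<^bsub>S\<^esub> c = h (x + y)" ..
        then show "a \<otimes>\<^bsub>add_monoid S\<^esub> c \<in> h ` W"
          using ideal_poly_add[OF W xy(1,3)] by simp
      qed
    next
      fix a x assume aW: "a \<in> h ` W" and x: "x \<in> carrier S"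
      obtain w where w: "w \<in> W" "a = h w" using aW by auto
      obtain r where r: "r \<in> carrier (poly_ring V)" "x = h r" using presents_surj[OF pr x] by blast
      have wR: "w \<in> carrier (poly_ring V)" by (rule subsetD[OF ideal_poly_subset[OF W] w(1)])
      have "x \<otimes>\<^bsub>S\<^esub> a = h (r * w)" unfolding w(2) r(2) by (rule presentsD(7)[OF pr r(1) wR, symmetric])
      then show xa: "x \<otimes>\<^bsub>S\<^esub> a \<in> h ` W" using ideal_poly_mult[OF W r(1) w(1)] by simp
      have "a \<in> carrier S" unfolding w(2) by (rule presentsD(5)[OF pr wR])
      then show "a \<otimes>\<^bsub>S\<^esub> x \<in> h ` W" using xa S.m_comm[OF _ x] by simp
    qed
    then have "J \<subseteq> h ` W" unfolding J_def
      by (rule S.genideal_minimal) (use IW in auto)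
    with hp obtain w where w: "w \<in> W" "h p = h w" by blast
    have "p - w \<in> I"
      using presents_eq_iff[OF pr p subsetD[OF ideal_poly_subset[OF W] w(1)]] w(2) by blast
    then have "p - w \<in> W" using IW by blast
    then show "p \<in> W" using ideal_poly_add[OF W _ w(1), of "p - w"] by simp
  qed
  show "presents V W (\<lambda>p. J +>\<^bsub>S\<^esub> h p) (S Quot J)"
    unfolding presents_def
  proof (intro conjI ballI)
    show "cring (S Quot J)" by (rule J.quotient_is_cring[OF S.is_cring])
    show "(\<lambda>p. J +>\<^bsub>S\<^esub> h p) \<in> Ring.ring_hom (poly_ring V) (S Quot J)"
      using ring_hom_trans[OF presentsD(2)[OF pr] J.rcos_ring_hom] by (simp add: comp_def)
    show "(\<lambda>p. J +>\<^bsub>S\<^esub> h p) ` carrier (poly_ring V) = carrier (S Quot J)"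
      unfolding FactRing_def A_RCOSETS_def' partial_object.select_convs presentsD(4)[OF pr, symmetric]
      by blast
    show "W \<subseteq> carrier (poly_ring V)" by (rule ideal_poly_subset[OF W])
    fix p :: "'k mpoly" assume p: "p \<in> carrier (poly_ring V)"
    have "J +>\<^bsub>S\<^esub> h p = J \<longleftrightarrow> h p \<in> J"
      using J.a_rcos_const J.a_rcos_self[OF presentsD(5)[OF pr p]] by blast
    then show "(J +>\<^bsub>S\<^esub> h p = \<zero>\<^bsub>S Quot J\<^esub>) = (p \<in> W)" using WJ[OF p] by (simp add: FactRing_def)
  qed
qed

lemma ring_hom_between_presented:
  fixes I1 I2 :: "'k::field mpoly set"
  assumes 1: "presents V1 I1 h1 S1" and 2: "presents V2 I2 h2 S2" and V: "V1 \<subseteq> V2"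
    and F: "\<And>p. p \<in> carrier (poly_ring V1) \<Longrightarrow> F (h1 p) = h2 p"
  shows "F \<in> Ring.ring_hom S1 S2"
proof (rule ring_hom_memI)
  note sub = subsetD[OF poly_ring_mono[OF V]]
  have ex: "\<exists>p\<in>carrier (poly_ring V1). x = h1 p" if "x \<in> carrier S1" for x
    using presents_surj[OF 1 that] .
  show "F x \<in> carrier S2" if x: "x \<in> carrier S1" for x
  proof -
    obtain p where p: "p \<in> carrier (poly_ring V1)" "x = h1 p" using ex[OF x] by blast
    show ?thesis unfolding p(2) F[OF p(1)] by (rule presentsD(5)[OF 2 sub[OF p(1)]])
  qed
  show "F (x \<otimes>\<^bsub>S1\<^esub> y) = F x \<otimes>\<^bsub>S2\<^esub> F y" if xy: "x \<in> carrier S1" "y \<in> carrier S1" for x y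
  proof -
    obtain p q where pq: "p \<in> carrier (poly_ring V1)" "x = h1 p" "q \<in> carrier (poly_ring V1)" "y = h1 q"
      using ex[OF xy(1)] ex[OF xy(2)] by blast
    then show ?thesis
      by (simp add: F presentsD(7)[OF 1, symmetric] presentsD(7)[OF 2] sub)
  qed
  show "F (x \<oplus>\<^bsub>S1\<^esub> y) = F x \<oplus>\<^bsub>S2\<^esub> F y" if xy: "x \<in> carrier S1" "y \<in> carrier S1" for x y
  proof -
    obtain p q where pq: "p \<in> carrier (poly_ring V1)" "x = h1 p" "q \<in> carrier (poly_ring V1)" "y = h1 q"
      using ex[OF xy(1)] ex[OF xy(2)] by blast
    then show ?thesis
      by (simp add: F presentsD(6)[OF 1, symmetric] presentsD(6)[OF 2] sub)
  qed
  show "F \<one>\<^bsub>S1\<^esub> = \<one>\<^bsub>S2\<^esub>"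
    unfolding presentsD(9)[OF 1, symmetric] F[OF poly_ring_one] by (rule presentsD(9)[OF 2])
qed

lemma ring_iso_between_presented:
  fixes I1 I2 :: "'k::field mpoly set"
  assumes 1: "presents V1 I1 h1 S1" and 2: "presents V2 I2 h2 S2" and V: "V1 \<subseteq> V2"
    and F: "\<And>p. p \<in> carrier (poly_ring V1) \<Longrightarrow> F (h1 p) = h2 p"
    and inj: "I2 \<inter> carrier (poly_ring V1) \<subseteq> I1"
    and surj: "\<And>p. p \<in> carrier (poly_ring V2) \<Longrightarrow> \<exists>q\<in>carrier (poly_ring V1). p - q \<in> I2"
  shows "F \<in> ring_iso S1 S2"
  unfolding ring_iso_def
proof (intro CollectI conjI bij_betw_imageI)
  note sub = subsetD[OF poly_ring_mono[OF V]]
  show hom: "F \<in> Ring.ring_hom S1 S2" by (rule ring_hom_between_presented[OF 1 2 V F])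
  show "inj_on F (carrier S1)"
  proof (rule inj_onI)
    fix x y assume x: "x \<in> carrier S1" and y: "y \<in> carrier S1" and eq: "F x = F y"
    obtain p q where pq: "p \<in> carrier (poly_ring V1)" "x = h1 p" "q \<in> carrier (poly_ring V1)" "y = h1 q"
      using presents_surj[OF 1 x] presents_surj[OF 1 y] by blast
    have "h2 p = h2 q" using eq pq F by simp
    then have "p - q \<in> I2" using presents_eq_iff[OF 2 sub[OF pq(1)] sub[OF pq(3)]] by simp
    then have "p - q \<in> I1" using inj pq by blast
    then show "x = y" using presents_eq_iff[OF 1 pq(1,3)] pq by simp
  qed
  show "F ` carrier S1 = carrier S2"
  proof
    show "F ` carrier S1 \<subseteq> carrier S2" using ring_hom_closed[OF hom] by blast
    show "carrier S2 \<subseteq> F ` carrier S1"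
    proof
      fix y assume y: "y \<in> carrier S2"
      obtain p where p: "p \<in> carrier (poly_ring V2)" "y = h2 p"
        using presents_surj[OF 2 y] by blast
      obtain q where q: "q \<in> carrier (poly_ring V1)" "p - q \<in> I2" using surj[OF p(1)] by blast
      have "y = F (h1 q)" using p q(2) presents_eq_iff[OF 2 p(1) sub[OF q(1)]] F[OF q(1)] by simp
      then show "y \<in> F ` carrier S1" using presentsD(5)[OF 1 q(1)] by blast
    qed
  qed
qed

lemma id_poly_ring_hom: "V \<subseteq> V' \<Longrightarrow> id \<in> Ring.ring_hom (poly_ring V) (poly_ring V')"
  using poly_ring_mono[of V V'] by (intro ring_hom_memI) auto

lemma restrict_poly_ring_hom:
  assumes "h \<in> Ring.ring_hom (poly_ring V') S" "V \<subseteq> V'"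
  shows "h \<in> Ring.ring_hom (poly_ring V) S"
  using ring_hom_trans[OF id_poly_ring_hom[OF assms(2)] assms(1)] by simp

lemma class_in_ideal_if_relation:
  assumes "presents V I h S" "presents V I' (\<lambda>p. K +>\<^bsub>S\<^esub> h p) (S Quot K)" "ideal K S" "p \<in> I'"
    "p \<in> carrier (poly_ring V)"
  shows "h p \<in> K"
proof -
  interpret K: ideal K S by (rule assms(3))
  have "K +>\<^bsub>S\<^esub> h p = K"
    using presentsD(10)[OF assms(2,5)] assms(4) by (simp add: FactRing_def)
  then show ?thesis using K.a_rcos_self[OF presentsD(5)[OF assms(1,5)]] by simp
qed

text \<open>
  Spanning and independence can be tested on representatives, because both structure maps are
  surjective and the module action is compatible with the inclusion of the polynomial rings.
\<close>

lemma module_basis_presented: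
  fixes v :: "'i \<Rightarrow> 'k::field mpoly"
  assumes 1: "presents V1 I1 h1 A" and 2: "presents V2 I2 h2 S" and V: "V1 \<subseteq> V2"
    and F: "\<And>p. p \<in> carrier (poly_ring V1) \<Longrightarrow> F (h1 p) = h2 p"
    and N: "finite N" and v: "\<And>i. i \<in> N \<Longrightarrow> v i \<in> carrier (poly_ring V2)"
    and span: "\<And>p. p \<in> carrier (poly_ring V2) \<Longrightarrow>
      \<exists>a. (\<forall>i\<in>N. a i \<in> carrier (poly_ring V1)) \<and> p - (\<Sum>i\<in>N. a i * v i) \<in> I2"
    and indep: "\<And>a. (\<forall>i\<in>N. a i \<in> carrier (poly_ring V1)) \<Longrightarrow>
      (\<Sum>i\<in>N. a i * v i) \<in> I2 \<Longrightarrow> \<forall>i\<in>N. a i \<in> I1"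
  shows "module_basis A (module_via F S) N (\<lambda>i. h2 (v i))"
proof -
  note sub = subsetD[OF poly_ring_mono[OF V]]
  interpret A: cring A by (rule presentsD(1)[OF 1])
  interpret S: cring S by (rule presentsD(1)[OF 2])
  have hom: "F \<in> Ring.ring_hom A S" by (rule ring_hom_between_presented[OF 1 2 V F])
  let ?M = "module_via F S"
  have M: "carrier ?M = carrier S" "add ?M = add S" "zero ?M = zero S"
    "\<And>a x. a \<odot>\<^bsub>?M\<^esub> x = F a \<otimes>\<^bsub>S\<^esub> x"
    by (simp_all add: module_via_def)
  have mod: "module A ?M"
  proof (rule moduleI)
    show "abelian_group ?M"
    proof (rule abelian_groupI)
      fix x assume "x \<in> carrier ?M"
      then have x: "x \<in> carrier S" by (simp add: M)
      show "\<exists>y\<in>carrier ?M. y \<oplus>\<^bsub>?M\<^esub> x = \<zero>\<^bsub>?M\<^esub>"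
        unfolding M by (rule bexI[where x = "\<ominus>\<^bsub>S\<^esub> x"]) (use S.l_neg[OF x] x in auto)
    qed (simp_all add: M S.a_ac)
  qed (use A.is_cring ring_hom_closed[OF hom] ring_hom_add[OF hom] ring_hom_mult[OF hom]
        ring_hom_one[OF hom] in \<open>simp_all add: M S.l_distr S.r_distr S.m_assoc\<close>)
  interpret M: module A ?M by (rule mod)
  have comb: "(\<Oplus>\<^bsub>?M\<^esub>i\<in>B. h1 (a i) \<odot>\<^bsub>?M\<^esub> h2 (v i)) = h2 (\<Sum>i\<in>B. a i * v i)"
    if a: "\<forall>i\<in>N. a i \<in> carrier (poly_ring V1)" and B: "finite B" "B \<subseteq> N" for a B
    using B
  proof (induction B rule: finite_induct)
    case empty
    show ?case by (simp add: presentsD(8)[OF 2] M)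
  next
    case (insert i B)
    have a1: "a j \<in> carrier (poly_ring V1)" and v2: "v j \<in> carrier (poly_ring V2)"
      if "j \<in> insert i B" for j
    proof -
      have j: "j \<in> N" using that insert.prems by blast
      show "a j \<in> carrier (poly_ring V1)" using a j by (rule bspec)
      show "v j \<in> carrier (poly_ring V2)" using j by (rule v)
    qed
    note a2 = sub[OF a1]
    have "h1 (a j) \<odot>\<^bsub>?M\<^esub> h2 (v j) \<in> carrier ?M" if j: "j \<in> insert i B" for j
      unfolding M F[OF a1[OF j]]
      by (rule S.m_closed[OF presentsD(5)[OF 2 a2[OF j]] presentsD(5)[OF 2 v2[OF j]]])
    then have "(\<Oplus>\<^bsub>?M\<^esub>j\<in>insert i B. h1 (a j) \<odot>\<^bsub>?M\<^esub> h2 (v j))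
      = h1 (a i) \<odot>\<^bsub>?M\<^esub> h2 (v i) \<oplus>\<^bsub>?M\<^esub> (\<Oplus>\<^bsub>?M\<^esub>j\<in>B. h1 (a j) \<odot>\<^bsub>?M\<^esub> h2 (v j))"
      using insert.hyps by (intro M.finsum_insert) auto
    also have "\<dots> = h2 (a i * v i) \<oplus>\<^bsub>S\<^esub> h2 (\<Sum>j\<in>B. a j * v j)"
    proof -
      have "h1 (a i) \<odot>\<^bsub>?M\<^esub> h2 (v i) = h2 (a i * v i)"
        unfolding M F[OF a1[OF insertI1]] by (rule presentsD(7)[OF 2 a2 v2, symmetric]) simp_all
      moreover have "(\<Oplus>\<^bsub>?M\<^esub>j\<in>B. h1 (a j) \<odot>\<^bsub>?M\<^esub> h2 (v j)) = h2 (\<Sum>j\<in>B. a j * v j)"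
        using insert by blast
      ultimately show ?thesis by (simp only: M)
    qed
    also have "\<dots> = h2 (a i * v i + (\<Sum>j\<in>B. a j * v j))"
      by (intro presentsD(6)[OF 2, symmetric] poly_ring_mult poly_ring_sum a2 v2) simp_all
    finally show ?case using insert.hyps by simp
  qed
  show ?thesis
    unfolding module_basis_def
  proof (intro conjI ballI impI)
    show "(\<lambda>i. h2 (v i)) \<in> N \<rightarrow> carrier ?M" 
      unfolding M by (intro Pi_I presentsD(5)[OF 2] v)
  next
    fix u assume "u \<in> carrier ?M"
    then have u: "u \<in> carrier S" by (simp add: M)
    obtain p where p: "p \<in> carrier (poly_ring V2)" "u = h2 p"
      using presents_surj[OF 2 u] by blast
    obtain a where a: "\<forall>i\<in>N. a i \<in> carrier (poly_ring V1)" "p - (\<Sum>i\<in>N. a i * v i) \<in> I2"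
      using span[OF p(1)] by blast
    have "(\<Sum>i\<in>N. a i * v i) \<in> carrier (poly_ring V2)"
      by (intro poly_ring_sum poly_ring_mult v sub bspec[OF a(1)])
    then have "u = (\<Oplus>\<^bsub>?M\<^esub>i\<in>N. h1 (a i) \<odot>\<^bsub>?M\<^esub> h2 (v i))"
      using presents_eq_iff[OF 2 p(1)] a(2) p(2) comb[OF a(1) N order_refl] by simp
    moreover have "(\<lambda>i. h1 (a i)) \<in> N \<rightarrow> carrier A"
      by (intro Pi_I presentsD(5)[OF 1] bspec[OF a(1)])
    ultimately show "\<exists>a\<in>N \<rightarrow> carrier A. u = (\<Oplus>\<^bsub>?M\<^esub>i\<in>N. a i \<odot>\<^bsub>?M\<^esub> h2 (v i))"
      by (intro bexI[where x = "\<lambda>i. h1 (a i)"])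
  next
    fix a' i assume a': "a' \<in> N \<rightarrow> carrier A" and i: "i \<in> N"
      and 0: "(\<Oplus>\<^bsub>?M\<^esub>i\<in>N. a' i \<odot>\<^bsub>?M\<^esub> h2 (v i)) = \<zero>\<^bsub>?M\<^esub>"
    have "\<forall>i\<in>N. \<exists>p. p \<in> carrier (poly_ring V1) \<and> a' i = h1 p"
      using presents_surj[OF 1 Pi_mem[OF a']] by blast
    from bchoice[OF this] obtain a
      where a: "\<forall>i\<in>N. a i \<in> carrier (poly_ring V1)" "\<forall>i\<in>N. a' i = h1 (a i)" by blast
    have "(\<Oplus>\<^bsub>?M\<^esub>i\<in>N. a' i \<odot>\<^bsub>?M\<^esub> h2 (v i)) = (\<Oplus>\<^bsub>?M\<^esub>i\<in>N. h1 (a i) \<odot>\<^bsub>?M\<^esub> h2 (v i))"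
    proof (rule M.finsum_cong')
      show "(\<lambda>i. h1 (a i) \<odot>\<^bsub>?M\<^esub> h2 (v i)) \<in> N \<rightarrow> carrier ?M"
      proof (rule Pi_I)
        fix j assume j: "j \<in> N"
        show "h1 (a j) \<odot>\<^bsub>?M\<^esub> h2 (v j) \<in> carrier ?M"
          unfolding M F[OF bspec[OF a(1) j]]
          by (intro S.m_closed presentsD(5)[OF 2] v sub bspec[OF a(1)] j)
      qed
    qed (use a(2) in auto)
    also have "\<dots> = h2 (\<Sum>i\<in>N. a i * v i)" by (rule comb[OF a(1) N order_refl])
    finally have "h2 (\<Sum>i\<in>N. a i * v i) = \<zero>\<^bsub>S\<^esub>" using 0 by (simp only: M)
    moreover have "(\<Sum>i\<in>N. a i * v i) \<in> carrier (poly_ring V2)"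
      by (intro poly_ring_sum poly_ring_mult v sub bspec[OF a(1)])
    ultimately have "(\<Sum>i\<in>N. a i * v i) \<in> I2" using presentsD(10)[OF 2] by blast
    then have "a i \<in> I1" using indep[OF a(1)] i by blast
    then have "h1 (a i) = \<zero>\<^bsub>A\<^esub>" using presentsD(10)[OF 1 bspec[OF a(1) i]] by blast
    then show "a' i = \<zero>\<^bsub>A\<^esub>" using bspec[OF a(2) i] by simp
  qed (use mod N in auto)
qed

section \<open>Order ideals and the generic multiplication matrices\<close>

locale labelled_terms =
  fixes n \<mu> \<nu> \<eta> :: nat and Ord :: "pterm set" and t b :: "nat \<Rightarrow> pterm"
  assumes labelled: "labelled_order_ideal n Ord \<mu> \<nu> \<eta> t b"
    and nonempty: "Ord \<noteq> {}"
begin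

lemma Ord_terms: "s \<in> Ord \<Longrightarrow> s \<in> terms n"
  and finite_Ord: "finite Ord"
  and Ord_divisor: "s + u \<in> Ord \<Longrightarrow> s \<in> terms n \<Longrightarrow> u \<in> terms n \<Longrightarrow> s \<in> Ord"
  and bij_t: "bij_betw t {..<\<mu>} Ord"
  and bij_b: "bij_betw b {..<\<nu>} (border n Ord)"
  and eta_le: "\<eta> \<le> \<nu>"
  and corners: "monoid_ideal n (b ` {..<\<eta>}) = terms n - Ord"
  using labelled
  by (auto simp: labelled_order_ideal_def order_ideal_def minimal_generators_def)

lemma t_Ord: "i < \<mu> \<Longrightarrow> t i \<in> Ord"
  using bij_betwE[OF bij_t] by blast

lemma t_inj: "i < \<mu> \<Longrightarrow> j < \<mu> \<Longrightarrow> t i = t j \<longleftrightarrow> i = j"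
  using bij_betw_imp_inj_on[OF bij_t] by (auto simp: inj_on_def)

lemma Ord_eq_t: "s \<in> Ord \<Longrightarrow> \<exists>i<\<mu>. s = t i"
  using bij_betw_imp_surj_on[OF bij_t] by auto

lemma b_border: "j < \<nu> \<Longrightarrow> b j \<in> border n Ord"
  using bij_betwE[OF bij_b] by blast

lemma b_inj: "i < \<nu> \<Longrightarrow> j < \<nu> \<Longrightarrow> b i = b j \<longleftrightarrow> i = j"
  using bij_betw_imp_inj_on[OF bij_b] by (auto simp: inj_on_def)

lemma border_eq_b: "s \<in> border n Ord \<Longrightarrow> \<exists>j<\<nu>. s = b j"
  using bij_betw_imp_surj_on[OF bij_b] by auto

lemma b_notin_Ord: "j < \<nu> \<Longrightarrow> b j \<notin> Ord"
  using b_border by (auto simp: border_def)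

lemma b_eq_var_t: "j < \<nu> \<Longrightarrow> \<exists>k<n. \<exists>i<\<mu>. b j = var_term (X k) + t i"
  using b_border Ord_eq_t by (fastforce simp: border_def)

lemma var_t_cases:
  assumes "k < n" "s \<in> Ord"
  obtains (inside) "var_term (X k) + s \<in> Ord"
    | (border) j where "j < \<nu>" "var_term (X k) + s = b j"
  using assms border_eq_b[of "var_term (X k) + s"] by (auto simp: border_def)

lemma terms_add_iff: "s + u \<in> terms n \<longleftrightarrow> s \<in> terms n \<and> u \<in> terms n"
  by (simp add: terms_def keys_add_term)

lemma terms_var_iff: "var_term v \<in> terms n \<longleftrightarrow> v \<in> xvars n"
  by (simp add: terms_def)

lemma terms_X: "k < n \<Longrightarrow> var_term (X k) \<in> terms n"
  by (auto simp: terms_var_iff xvars_def)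

lemma b_terms: "j < \<nu> \<Longrightarrow> b j \<in> terms n"
  using b_eq_var_t terms_add_iff terms_X Ord_terms t_Ord by metis

lemma Ord_divisor': "s + u \<in> Ord \<Longrightarrow> s \<in> Ord" "s + u \<in> Ord \<Longrightarrow> u \<in> Ord"
  using Ord_divisor[of s u] Ord_divisor[of u s] Ord_terms[of "s + u"]
  by (auto simp: terms_add_iff add.commute)

lemma zero_Ord: "0 \<in> Ord"
  using nonempty Ord_divisor'(1)[of 0] by auto

text \<open>
  A border term that is not a corner is a proper multiple of a corner, so dividing it by a
  suitable indeterminate \<open>X k\<close> keeps it outside \<open>Ord\<close>.  As it is also \<open>X l\<close> times an element of
  \<open>Ord\<close>, it is \<open>X k * X l\<close> times a term whose two multiples by \<open>X k\<close> and \<open>X l\<close> are in \<open>Ord\<close> and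
  in the border: the commutator of the two multiplication matrices relates the coefficients
  of two border elements.
\<close>

lemma noncorner_border_cases:
  assumes "j < \<nu>"
  obtains (corner) "j < \<eta>"
    | (step) k l m p i where "k < n" "l < n" "m < \<nu>" "p < \<mu>" "i < \<mu>"
      "b j = var_term (X k) + b m" "b m = var_term (X l) + t p"
      "t i = var_term (X k) + t p" "b j = var_term (X l) + t i"
proof -
  have "b j \<in> monoid_ideal n (b ` {..<\<eta>})"
    using corners b_terms b_notin_Ord assms by blast
  then obtain g u where g: "g < \<eta>" "b j = b g + u" "u \<in> terms n"
    by (auto simp: monoid_ideal_def)
  show ?thesis
  proof (cases "u = 0")
    case True
    then have "j = g" using g b_inj[of j g] assms eta_le by auto
    then show ?thesis using corner g by simp
  next
    case False
    then obtain v where v: "v \<in> Poly_Mapping.keys u" by (metis all_not_in_conv keys_eq_empty)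
    then obtain k where k: "k < n" "v = X k" using g by (auto simp: terms_def xvars_def)
    define w where "w = b g + (u - var_term v)"
    have u: "u = var_term v + (u - var_term v)" by (rule term_split_var[OF v])
    have bj: "b j = var_term (X k) + w" unfolding w_def k(2)[symmetric] g(2)
      by (subst u) (simp only: add.left_commute)
    have "u - var_term v \<in> terms n" using u g(3) terms_add_iff by metis
    then have "w \<in> monoid_ideal n (b ` {..<\<eta>})"
      unfolding w_def monoid_ideal_def using g(1) by blast
    then have w: "w \<notin> Ord" using corners by blast
    obtain l i where l: "l < n" "i < \<mu>" "b j = var_term (X l) + t i"
      using b_eq_var_t[OF assms] by blast
    \<comment> \<open>so that \<open>X k\<close> divides \<open>t i\<close> and not only \<open>b j\<close>\<close>
    have "k \<noteq> l"
    proof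
      assume "k = l"
      then have "w = t i" using l(3) bj by simp
      then show False using w t_Ord[OF l(2)] by simp
    qed
    have "Poly_Mapping.lookup (b j) (X k) \<noteq> 0" unfolding bj by (simp add: lookup_add lookup_var_term)
    then have "Poly_Mapping.lookup (t i) (X k) \<noteq> 0"
      unfolding l(3) using \<open>k \<noteq> l\<close> by (simp add: lookup_add lookup_var_term)
    then have "X k \<in> Poly_Mapping.keys (t i)" by (simp add: in_keys_iff)
    from term_split_var[OF this] obtain s where s: "t i = var_term (X k) + s" by blast
    have "s \<in> Ord" using Ord_divisor'(2) t_Ord[OF l(2)] s by simp
    then obtain p where p: "p < \<mu>" "s = t p" using Ord_eq_t by blast
    have "var_term (X k) + w = var_term (X k) + (var_term (X l) + s)"
      using bj l(3) s by (simp add: add.left_commute)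
    then have ws: "w = var_term (X l) + s" by simp
    then obtain m where m: "m < \<nu>" "w = b m"
      using var_t_cases[OF l(1) \<open>s \<in> Ord\<close>] w by metis
    show ?thesis using step[OF k(1) l(1) m(1) p(1) l(2)] bj m ws s p l(3) by simp
  qed
qed

abbreviation mm :: "nat \<Rightarrow> nat \<Rightarrow> nat \<Rightarrow> 'k::field mpoly" where
  "mm k i q \<equiv> generic_mult_mat \<mu> \<nu> t b k $$ (i, q)"

lemma mm_inside:
  assumes "i < \<mu>" "q < \<mu>" "var_term (X k) + t q \<in> Ord"
  shows "mm k i q = (if t i = var_term (X k) + t q then 1 else 0)"
  using assms bij_betw_imp_surj_on[OF bij_t] by (auto simp: generic_mult_mat_def Let_def)

lemma mm_border:
  assumes "i < \<mu>" "q < \<mu>" "j < \<nu>" "var_term (X k) + t q = b j"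
  shows "mm k i q = cvar i j"
proof -
  have "b j \<notin> t ` {..<\<mu>}" using bij_betw_imp_surj_on[OF bij_t] b_notin_Ord assms by auto
  moreover have "(THE m. m < \<nu> \<and> b j = b m) = j"
    using assms b_inj by (intro the_equality) auto
  ultimately show ?thesis using assms by (simp add: generic_mult_mat_def Let_def)
qed

lemma cvar_Kc: "i < \<mu> \<Longrightarrow> j < \<nu> \<Longrightarrow> cvar i j \<in> carrier (Kc \<mu> \<nu>)"
  unfolding cvar_def by (rule poly_ring_var) (auto simp: cvars_def)

lemma mm_Kc:
  assumes "k < n" "i < \<mu>" "q < \<mu>"
  shows "mm k i q \<in> carrier (Kc \<mu> \<nu>)"
proof (rule var_t_cases[OF assms(1) t_Ord[OF assms(3)]])
  assume inside: "var_term (X k) + t q \<in> Ord"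
  show ?thesis unfolding mm_inside[OF assms(2,3) inside] by simp
next
  fix j assume border: "j < \<nu>" "var_term (X k) + t q = b j"
  show ?thesis unfolding mm_border[OF assms(2,3) border] by (rule cvar_Kc[OF assms(2) border(1)])
qed

lemma mm_mult_index:
  assumes "i < \<mu>" "j < \<mu>"
  shows "(generic_mult_mat \<mu> \<nu> t b k * generic_mult_mat \<mu> \<nu> t b l
       - generic_mult_mat \<mu> \<nu> t b l * generic_mult_mat \<mu> \<nu> t b k) $$ (i, j)
    = (\<Sum>q<\<mu>. mm k i q * mm l q j) - (\<Sum>q<\<mu>. mm l i q * mm k q j :: 'k::field mpoly)"
proof -
  have d: "dim_row (generic_mult_mat \<mu> \<nu> t b k :: 'k mpoly mat) = \<mu>"
    "dim_col (generic_mult_mat \<mu> \<nu> t b k :: 'k mpoly mat) = \<mu>" for k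
    by (simp_all add: generic_mult_mat_def)
  show ?thesis using assms
    by (simp add: d scalar_prod_def lessThan_atLeast0)
qed

lemma ideal_B_gens_Kc:
  "{(generic_mult_mat \<mu> \<nu> t b k * generic_mult_mat \<mu> \<nu> t b l
       - generic_mult_mat \<mu> \<nu> t b l * generic_mult_mat \<mu> \<nu> t b k) $$ (i, j)
      |i j k l. i < \<mu> \<and> j < \<mu> \<and> k < l \<and> l < n} \<subseteq> carrier (Kc \<mu> \<nu>)"
proof safe
  fix i j k l assume "i < \<mu>" "j < \<mu>" "k < l" "l < n"
  then show "(generic_mult_mat \<mu> \<nu> t b k * generic_mult_mat \<mu> \<nu> t b l
       - generic_mult_mat \<mu> \<nu> t b l * generic_mult_mat \<mu> \<nu> t b k) $$ (i, j) \<in> carrier (Kc \<mu> \<nu>)"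
    by (subst mm_mult_index)
      (auto intro!: poly_ring_diff poly_ring_sum poly_ring_mult mm_Kc)
qed

lemma ideal_ideal_B: "ideal (ideal_B n \<mu> \<nu> t b) (Kc \<mu> \<nu>)"
  unfolding ideal_B_def by (rule poly_genideal[OF ideal_B_gens_Kc])

lemma mm_commute:
  assumes "i < \<mu>" "j < \<mu>" "k < n" "l < n"
  shows "(\<Sum>q<\<mu>. mm k i q * mm l q j) - (\<Sum>q<\<mu>. mm l i q * mm k q j) \<in> ideal_B n \<mu> \<nu> t b"
proof -
  have *: "(\<Sum>q<\<mu>. mm k i q * mm l q j) - (\<Sum>q<\<mu>. mm l i q * mm k q j) \<in> ideal_B n \<mu> \<nu> t b"
    if "k < l" "l < n" for k l
    unfolding mm_mult_index[OF assms(1,2), symmetric] ideal_B_def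
    by (rule subsetD[OF poly_genideal_self[OF ideal_B_gens_Kc]]) (use that assms in blast)
  consider "k < l" | "l < k" | "k = l" by linarith
  then show ?thesis
  proof cases
    case 1
    then show ?thesis using * assms by blast
  next
    case 2
    then show ?thesis using ideal_poly_sym[OF ideal_ideal_B *[OF 2 assms(3)]] by simp
  next
    case 3
    then show ?thesis using ideal_poly_zero[OF ideal_ideal_B] by simp
  qed
qed

end

section \<open>Coordinates with respect to the order ideal\<close>

text \<open>
  The factor of a term that involves only the coefficient indeterminates.
\<close>

lift_definition cpart :: "pterm \<Rightarrow> pterm"
  is "\<lambda>s v. case v of X k \<Rightarrow> 0 | C i j \<Rightarrow> s v"
proof -
  fix s :: "indet \<Rightarrow> nat"
  assume "finite {v. s v \<noteq> 0}"
  then show "finite {v. (case v of X k \<Rightarrow> 0 | C i j \<Rightarrow> s v) \<noteq> 0}"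
    by (rule rev_finite_subset) (auto split: indet.split_asm)
qed

lemma cpart_zero: "cpart 0 = 0"
  by transfer (auto split: indet.splits)

lemma cpart_add: "cpart (s + u) = cpart s + cpart u"
  by transfer (auto split: indet.splits)

lemma cpart_X: "cpart (var_term (X k)) = 0"
  by (rule poly_mapping_eqI) (simp add: cpart.rep_eq lookup_var_term split: indet.splits)

lemma cpart_C: "cpart (var_term (C i j)) = var_term (C i j)"
  by (rule poly_mapping_eqI) (auto simp: cpart.rep_eq lookup_var_term split: indet.splits)

lemma keys_cpart: "Poly_Mapping.keys s \<subseteq> xvars n \<union> cvars \<mu> \<nu> \<Longrightarrow> Poly_Mapping.keys (cpart s) \<subseteq> cvars \<mu> \<nu>"
  by (auto simp: in_keys_iff cpart.rep_eq xvars_def subset_iff split: indet.splits)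

text \<open>
  Applies \<open>M k\<close> as often as \<open>X k\<close> occurs in \<open>s\<close>, for \<open>k < m\<close> and in the order of the indices.  The fixed
  order makes the function well defined although the operators commute only up to congruence.
\<close>

primrec act :: "(nat \<Rightarrow> 'v \<Rightarrow> 'v) \<Rightarrow> 'v \<Rightarrow> nat \<Rightarrow> pterm \<Rightarrow> 'v" where
  "act M e 0 s = e"
| "act M e (Suc m) s = (M m ^^ Poly_Mapping.lookup s (X m)) (act M e m s)"

lemma act_zero: "act M e m 0 = e"
  by (induction m) simp_all

lemma act_cong:
  "(\<And>k. k < m \<Longrightarrow> Poly_Mapping.lookup s (X k) = Poly_Mapping.lookup u (X k)) \<Longrightarrow> act M e m s = act M e m u"
  by (induction m) simp_all

context labelled_terms
begin

definition mult_vec :: "nat \<Rightarrow> (nat \<Rightarrow> 'k::field mpoly) \<Rightarrow> nat \<Rightarrow> 'k mpoly" where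
  "mult_vec k v i = (\<Sum>q<\<mu>. mm k i q * v q)"

definition Ord_unit :: "pterm \<Rightarrow> nat \<Rightarrow> 'k::field mpoly" where
  "Ord_unit s i = (if t i = s then 1 else 0)"

text \<open>
  The polynomial \<open>p\<close>, applied to the unit vector that belongs to the term 1: indeterminates
  \<open>X k\<close> act by the multiplication matrices, coefficient indeterminates act as scalars.
\<close>

definition coords :: "'k::field mpoly \<Rightarrow> nat \<Rightarrow> 'k mpoly" where
  "coords p i = (\<Sum>s\<in>Poly_Mapping.keys p. Poly_Mapping.single 0 (Poly_Mapping.lookup p s) *
     (of_term (cpart s) * act mult_vec (Ord_unit 0) n s i))"

lemma coords_superset:
  assumes "finite A" "Poly_Mapping.keys p \<subseteq> A"
  shows "coords p i = (\<Sum>s\<in>A. Poly_Mapping.single 0 (Poly_Mapping.lookup p s) *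
     (of_term (cpart s) * act mult_vec (Ord_unit 0) n s i))"
  unfolding coords_def
  by (rule sum.mono_neutral_left) (use assms in \<open>auto simp: not_in_keys_iff_lookup_eq_zero\<close>)

lemma coords_single:
  "coords (Poly_Mapping.single s c) i
     = Poly_Mapping.single 0 c * (of_term (cpart s) * act mult_vec (Ord_unit 0) n s i)"
  by (subst coords_superset[of "{s}"]) auto

lemma coords_zero: "coords 0 i = 0"
  by (simp add: coords_def)

lemma coords_add: "coords (p + q) i = coords p i + coords q i"
proof -
  let ?A = "Poly_Mapping.keys p \<union> Poly_Mapping.keys q"
  have "finite ?A" by simp
  then show ?thesis
    by (simp add: coords_superset[of ?A] keys_add lookup_add single_add distrib_right sum.distrib)
qed

lemma coords_uminus: "coords (- p) i = - coords p i"
proof -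
  have "coords (- p) i + coords p i = 0"
    unfolding coords_add[symmetric] by (simp add: coords_zero)
  then show ?thesis by (rule eq_neg_iff_add_eq_0[THEN iffD2])
qed

lemma coords_diff: "coords (p - q) i = coords p i - coords q i"
  using coords_add[of p "- q" i] by (simp add: coords_uminus)

lemma coords_sum: "coords (sum f A) i = (\<Sum>x\<in>A. coords (f x) i)"
  by (induction A rule: infinite_finite_induct) (simp_all add: coords_zero coords_add)

lemma coords_one: "coords 1 i = Ord_unit 0 i"
  using coords_single[of 0 1 i] by (simp add: cpart_zero of_term_zero act_zero)

lemma coords_mult_Kc:
  assumes q: "q \<in> carrier (Kc \<mu> \<nu>)" and p: "p \<in> carrier (Kxc n \<mu> \<nu>)"
  shows "coords (q * p) i = q * coords p i"
  using q
proof (induction rule: poly_ring_induct)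
  case (const c)
  show ?case using p
  proof (induction rule: poly_ring_monomial_induct)
    case (monomial s d)
    have 1: "Poly_Mapping.single 0 c * Poly_Mapping.single s d = Poly_Mapping.single s (c * d)"
      and 2: "Poly_Mapping.single 0 (c * d) = Poly_Mapping.single 0 c * (Poly_Mapping.single 0 d :: 'a mpoly)"
      by (simp_all add: mult_single)
    show ?case unfolding 1 coords_single 2 by (simp only: mult.assoc)
  qed (simp add: coords_add distrib_left)
next
  case (add q1 q2)
  then show ?case by (simp add: coords_add distrib_right)
next
  case (var v q)
  then obtain i' j where v: "v = C i' j" by (auto simp: cvars_def)
  have qp: "q * p \<in> carrier (Kxc n \<mu> \<nu>)"
    using var(2) p poly_ring_mono[of "cvars \<mu> \<nu>" "xvars n \<union> cvars \<mu> \<nu>"] by blast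
  then have "coords (of_term (var_term v) * (q * p)) i = of_term (var_term v) * coords (q * p) i"
  proof (induction rule: poly_ring_monomial_induct)
    case (monomial s d)
    have "of_term (var_term v) * Poly_Mapping.single s d = Poly_Mapping.single (var_term v + s) d"
      by (simp add: of_term_def mult_single)
    moreover have "act mult_vec (Ord_unit 0) n (var_term v + s) = (act mult_vec (Ord_unit 0) n s :: nat \<Rightarrow> 'a mpoly)"
      by (rule act_cong) (simp add: v lookup_add lookup_var_term)
    ultimately show ?case
      by (simp add: coords_single cpart_add v cpart_C of_term_add ac_simps)
  qed (simp add: coords_add distrib_left)
  then show ?case using var.IH by (simp add: mult.assoc)
qed

lemma Kc_Kxc: "carrier (Kc \<mu> \<nu>) \<subseteq> carrier (Kxc n \<mu> \<nu>)"
  by (rule poly_ring_mono) simp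

lemma of_term_t_Kxc: "s \<in> Ord \<Longrightarrow> of_term s \<in> carrier (Kxc n \<mu> \<nu>)"
  using Ord_terms[of s] by (intro poly_ring_of_term) (auto simp: terms_def)

lemma of_term_b_Kxc: "j < \<nu> \<Longrightarrow> of_term (b j) \<in> carrier (Kxc n \<mu> \<nu>)"
  using b_terms[of j] by (intro poly_ring_of_term) (auto simp: terms_def)

lemma generic_prebasis_Kxc:
  assumes "j < \<nu>"
  shows "generic_prebasis \<mu> t b j \<in> carrier (Kxc n \<mu> \<nu>)"
  unfolding generic_prebasis_def
  by (intro poly_ring_diff poly_ring_sum poly_ring_mult of_term_b_Kxc of_term_t_Kxc t_Ord
      subsetD[OF Kc_Kxc] cvar_Kc assms) simp_all

context
  fixes J :: "'k::field mpoly set"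
  assumes J: "ideal J (Kc \<mu> \<nu>)" and BJ: "ideal_B n \<mu> \<nu> t b \<subseteq> J"
begin

definition Kc_vec :: "(nat \<Rightarrow> 'k mpoly) \<Rightarrow> bool" where
  "Kc_vec v \<longleftrightarrow> (\<forall>i<\<mu>. v i \<in> carrier (Kc \<mu> \<nu>))"

definition cong_vec :: "(nat \<Rightarrow> 'k mpoly) \<Rightarrow> (nat \<Rightarrow> 'k mpoly) \<Rightarrow> bool" where
  "cong_vec v w \<longleftrightarrow> (\<forall>i<\<mu>. v i - w i \<in> J)"

lemma cong_vec_refl: "cong_vec v v"
  by (simp add: cong_vec_def ideal_poly_zero[OF J])

lemma cong_vec_trans [trans]: "cong_vec u v \<Longrightarrow> cong_vec v w \<Longrightarrow> cong_vec u w"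
  using ideal_poly_trans[OF J] unfolding cong_vec_def by blast

lemma mult_vec_diff: "mult_vec k v i - mult_vec k w i = (\<Sum>q<\<mu>. mm k i q * (v q - w q))"
  by (simp add: mult_vec_def sum_subtractf right_diff_distrib)

lemma mult_vec_cong: "k < n \<Longrightarrow> cong_vec v w \<Longrightarrow> cong_vec (mult_vec k v) (mult_vec k w)"
  unfolding cong_vec_def mult_vec_diff
  by (intro allI impI ideal_poly_sum[OF J] ideal_poly_mult[OF J] mm_Kc) simp_all

lemma mult_vec_Kc: "k < n \<Longrightarrow> Kc_vec v \<Longrightarrow> Kc_vec (mult_vec k v)"
  unfolding Kc_vec_def mult_vec_def
  by (intro allI impI poly_ring_sum poly_ring_mult mm_Kc) simp_all

lemma mult_vec_mult_vec:
  "mult_vec k (mult_vec l v) i = (\<Sum>r<\<mu>. (\<Sum>q<\<mu>. mm k i q * mm l q r) * v r)"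
  unfolding mult_vec_def sum_distrib_left sum_distrib_right
  by (subst sum.swap) (simp only: mult.assoc)

lemma mult_vec_commute:
  assumes "k < n" "l < n" "Kc_vec v"
  shows "cong_vec (mult_vec k (mult_vec l v)) (mult_vec l (mult_vec k v))"
  unfolding cong_vec_def
proof (intro allI impI)
  fix i assume i: "i < \<mu>"
  have aux: "(\<Sum>r<\<mu>. f r * v r) - (\<Sum>r<\<mu>. g r * v r) = (\<Sum>r<\<mu>. v r * (f r - g r))" for f g
    by (simp add: sum_subtractf right_diff_distrib mult.commute)
  have "mult_vec k (mult_vec l v) i - mult_vec l (mult_vec k v) i
    = (\<Sum>r<\<mu>. v r * ((\<Sum>q<\<mu>. mm k i q * mm l q r) - (\<Sum>q<\<mu>. mm l i q * mm k q r)))"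
    unfolding mult_vec_mult_vec by (rule aux)
  also have "\<dots> \<in> J"
    by (intro ideal_poly_sum[OF J] ideal_poly_mult[OF J] subsetD[OF BJ] mm_commute assms(1,2) i
        assms(3)[unfolded Kc_vec_def, rule_format]) simp_all
  finally show "mult_vec k (mult_vec l v) i - mult_vec l (mult_vec k v) i \<in> J" .
qed

lemma funpow_mult_vec_Kc: "k < n \<Longrightarrow> Kc_vec v \<Longrightarrow> Kc_vec ((mult_vec k ^^ a) v)"
  by (induction a) (simp_all only: funpow.simps comp_apply id_apply mult_vec_Kc)

lemma funpow_mult_vec_cong:
  "k < n \<Longrightarrow> cong_vec v w \<Longrightarrow> cong_vec ((mult_vec k ^^ a) v) ((mult_vec k ^^ a) w)"
  by (induction a) (simp_all only: funpow.simps comp_apply id_apply mult_vec_cong)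

lemma funpow_mult_vec_commute:
  assumes "k < n" "l < n" "Kc_vec v"
  shows "cong_vec ((mult_vec k ^^ a) (mult_vec l v)) (mult_vec l ((mult_vec k ^^ a) v))"
proof (induction a)
  case 0
  show ?case by (simp add: cong_vec_refl)
next
  case (Suc a)
  have "cong_vec ((mult_vec k ^^ Suc a) (mult_vec l v)) (mult_vec k (mult_vec l ((mult_vec k ^^ a) v)))"
    using mult_vec_cong[OF assms(1) Suc] by (simp only: funpow.simps comp_apply)
  also have "cong_vec \<dots> (mult_vec l (mult_vec k ((mult_vec k ^^ a) v)))"
    by (intro mult_vec_commute funpow_mult_vec_Kc assms)
  finally show ?case by (simp only: funpow.simps comp_apply)
qed

lemma Kc_vec_unit: "Kc_vec (Ord_unit s)"
  by (simp add: Kc_vec_def Ord_unit_def)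

lemma act_Kc: "m \<le> n \<Longrightarrow> Kc_vec (act mult_vec (Ord_unit 0) m s)"
  by (induction m) (simp_all add: Kc_vec_unit funpow_mult_vec_Kc del: funpow.simps)

text \<open>
  In \<open>act\<close> the factor \<open>X k\<close> is applied in the middle of the product; commutativity modulo \<open>J\<close> moves it to
  the front.
\<close>

lemma act_X:
  assumes "k < m" "m \<le> n"
  shows "cong_vec (act mult_vec (Ord_unit 0) m (var_term (X k) + s)) (mult_vec k (act mult_vec (Ord_unit 0) m s))"
  using assms
proof (induction m)
  case (Suc m)
  let ?e = "Ord_unit 0 :: nat \<Rightarrow> 'k mpoly"
  show ?case
  proof (cases "k = m")
    case True
    have "act mult_vec ?e m (var_term (X k) + s) = act mult_vec ?e m s"
      by (rule act_cong) (simp add: True lookup_add lookup_var_term)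
    then have "act mult_vec ?e (Suc m) (var_term (X k) + s) = mult_vec k (act mult_vec ?e (Suc m) s)"
      by (simp add: True lookup_add lookup_var_term)
    then show ?thesis using cong_vec_refl by (simp only:)
  next
    case False
    let ?a = "Poly_Mapping.lookup s (X m)"
    have km: "k < m" "m \<le> n" "m < n" using False Suc.prems by simp_all
    have "Poly_Mapping.lookup (var_term (X k) + s) (X m) = ?a"
      using False by (simp add: lookup_add lookup_var_term)
    moreover have "cong_vec ((mult_vec m ^^ ?a) (act mult_vec ?e m (var_term (X k) + s)))
        ((mult_vec m ^^ ?a) (mult_vec k (act mult_vec ?e m s)))"
      by (rule funpow_mult_vec_cong[OF km(3) Suc.IH[OF km(1,2)]])
    moreover have "cong_vec ((mult_vec m ^^ ?a) (mult_vec k (act mult_vec ?e m s)))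
        (mult_vec k ((mult_vec m ^^ ?a) (act mult_vec ?e m s)))"
      by (rule funpow_mult_vec_commute[OF km(3) _ act_Kc[OF km(2)]]) (use km in simp)
    ultimately show ?thesis using cong_vec_trans by (simp only: act.simps)
  qed
qed simp

lemma coords_X:
  assumes "p \<in> carrier (Kxc n \<mu> \<nu>)" and k: "k < n"
  shows "cong_vec (coords (of_term (var_term (X k)) * p)) (mult_vec k (coords p))"
  using assms(1)
proof (induction rule: poly_ring_monomial_induct)
  case (monomial s c)
  let ?r = "Poly_Mapping.single 0 c * of_term (cpart s) :: 'k mpoly"
  have r: "?r \<in> carrier (Kc \<mu> \<nu>)"
    by (intro poly_ring_mult poly_ring_const poly_ring_of_term keys_cpart[OF monomial])
  have 1: "of_term (var_term (X k)) * Poly_Mapping.single s c = Poly_Mapping.single (var_term (X k) + s) c"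
    by (simp add: of_term_def mult_single)
  have 2: "coords (Poly_Mapping.single s c) = (\<lambda>i. ?r * act mult_vec (Ord_unit 0) n s i)"
    by (simp add: fun_eq_iff coords_single mult.assoc)
  have 3: "coords (Poly_Mapping.single (var_term (X k) + s) c) i
    = ?r * act mult_vec (Ord_unit 0) n (var_term (X k) + s) i" for i
    by (simp add: coords_single cpart_add cpart_X mult.assoc)
  have 4: "mult_vec k (\<lambda>i. ?r * act mult_vec (Ord_unit 0) n s i) i
    = ?r * mult_vec k (act mult_vec (Ord_unit 0) n s) i" for i
    by (simp add: mult_vec_def sum_distrib_left ac_simps)
  show ?case
    unfolding cong_vec_def 1 2 3 4 right_diff_distrib[symmetric]
    using act_X[OF k order_refl, of s] unfolding cong_vec_def
    by (intro allI impI ideal_poly_mult[OF J r]) simp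
next
  case (add p q)
  have "mult_vec k (coords (p + q)) i = mult_vec k (coords p) i + mult_vec k (coords q) i" for i
    by (simp add: mult_vec_def coords_add distrib_left sum.distrib)
  then show ?case
    unfolding cong_vec_def distrib_left coords_add
    using ideal_poly_add[OF J add(3)[unfolded cong_vec_def, rule_format]
        add(4)[unfolded cong_vec_def, rule_format]]
    by (simp only: add_diff_add) simp
qed

lemma coords_X_t:
  assumes q: "q < \<mu>" and k: "k < n" and unit: "cong_vec (coords (of_term (t q))) (Ord_unit (t q))"
  shows "cong_vec (coords (of_term (var_term (X k) + t q))) (\<lambda>i. mm k i q)"
proof -
  have "of_term (t q) \<in> carrier (Kxc n \<mu> \<nu>)"
    using Ord_terms[OF t_Ord[OF q]] by (intro poly_ring_of_term) (auto simp: terms_def)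
  then have "cong_vec (coords (of_term (var_term (X k) + t q))) (mult_vec k (coords (of_term (t q))))"
    unfolding of_term_add using k by (rule coords_X)
  also have "cong_vec \<dots> (mult_vec k (Ord_unit (t q)))"
    by (rule mult_vec_cong[OF k unit])
  finally have 1: "cong_vec (coords (of_term (var_term (X k) + t q))) (mult_vec k (Ord_unit (t q)))" .
  have 2: "mult_vec k (Ord_unit (t q)) = (\<lambda>i. mm k i q :: 'k mpoly)"
  proof
    fix i
    have "mult_vec k (Ord_unit (t q)) i = (\<Sum>j<\<mu>. if j = q then mm k i q else (0 :: 'k mpoly))"
      unfolding mult_vec_def Ord_unit_def using t_inj q by (intro sum.cong) auto
    then show "mult_vec k (Ord_unit (t q)) i = (mm k i q :: 'k mpoly)" using q by simp
  qed
  show ?thesis using 1 unfolding 2 .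
qed

text \<open>
  All divisors of a term of \<open>Ord\<close> are in \<open>Ord\<close>, so the term is reached from 1 without leaving \<open>Ord\<close>.
  The columns of the multiplication matrices used on the way are unit vectors.
\<close>

lemma coords_Ord:
  assumes "s \<in> Ord"
  shows "cong_vec (coords (of_term s)) (Ord_unit s)"
proof -
  have "Poly_Mapping.keys s \<subseteq> xvars n" using Ord_terms[OF assms] by (simp add: terms_def)
  then show ?thesis using assms
  proof (induction rule: term_induct)
    case zero
    have "coords (of_term 0) = (Ord_unit 0 :: nat \<Rightarrow> 'k mpoly)"
      by (simp add: fun_eq_iff of_term_zero coords_one)
    then show ?case by (simp add: cong_vec_refl)
  next
    case (var v s)
    have s: "s \<in> Ord" using var.prems by (rule Ord_divisor'(2))
    obtain q where q: "q < \<mu>" "s = t q" using Ord_eq_t[OF s] by blast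
    obtain k where k: "k < n" "v = X k" using var.hyps(1) by (auto simp: xvars_def)
    have "cong_vec (coords (of_term (var_term v + s))) (\<lambda>i. mm k i q)"
      unfolding q(2) k(2) using coords_X_t[OF q(1) k(1)] var.IH[OF s] unfolding q(2) by blast
    also have "cong_vec (\<lambda>i. mm k i q) (Ord_unit (var_term v + s))"
      using var.prems unfolding cong_vec_def q k Ord_unit_def
      by (simp add: mm_inside[OF _ q(1)] ideal_poly_zero[OF J])
    finally show ?case .
  qed
qed

definition coords_kernel :: "'k mpoly set" where
  "coords_kernel = {p \<in> carrier (Kxc n \<mu> \<nu>). \<forall>i<\<mu>. coords p i \<in> J}"

text \<open>
  The matrices have entries in \<open>K[c]\<close> and so preserve the vectors with entries in \<open>J\<close>; hence the
  kernel is closed under multiplication by each \<open>X k\<close>, and not only under \<open>K[c]\<close>.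
\<close>

lemma ideal_coords_kernel: "ideal coords_kernel (Kxc n \<mu> \<nu>)"
proof (rule ideal_poly_ringI)
  show "coords_kernel \<subseteq> carrier (Kxc n \<mu> \<nu>)" by (auto simp: coords_kernel_def)
  show "0 \<in> coords_kernel" by (simp add: coords_kernel_def coords_zero ideal_poly_zero[OF J])
  show add_kernel: "x + y \<in> coords_kernel" if "x \<in> coords_kernel" "y \<in> coords_kernel" for x y
    using that ideal_poly_add[OF J] by (simp add: coords_kernel_def coords_add)
  fix r x :: "'k mpoly"
  assume r: "r \<in> carrier (Kxc n \<mu> \<nu>)" and x: "x \<in> coords_kernel"
  have Kc: "q * y \<in> coords_kernel" if q: "q \<in> carrier (Kc \<mu> \<nu>)" and y: "y \<in> coords_kernel" for q y
  proof -
    have yx: "y \<in> carrier (Kxc n \<mu> \<nu>)" using y by (simp add: coords_kernel_def)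
    have "q * y \<in> carrier (Kxc n \<mu> \<nu>)" by (rule poly_ring_mult[OF subsetD[OF Kc_Kxc q] yx])
    then show ?thesis using y ideal_poly_mult[OF J q]
      by (simp add: coords_kernel_def coords_mult_Kc[OF q yx])
  qed
  show "r * x \<in> coords_kernel"
    using r
  proof (induction rule: poly_ring_induct)
    case (const c)
    show ?case by (rule Kc[OF poly_ring_const x])
  next
    case (add p q)
    show ?case unfolding distrib_right by (rule add_kernel[OF add(3,4)])
  next
    case (var v p)
    show ?case
    proof (cases "v \<in> cvars \<mu> \<nu>")
      case True
      show ?thesis unfolding mult.assoc by (rule Kc[OF poly_ring_var[OF True] var.IH])
    next
      case False
      then obtain k where k: "k < n" "v = X k" using var(1) by (auto simp: xvars_def)
      have px: "p * x \<in> carrier (Kxc n \<mu> \<nu>)" "cong_vec (coords (p * x)) (\<lambda>i. 0)"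
        using var.IH by (simp_all add: coords_kernel_def cong_vec_def)
      have "cong_vec (coords (of_term (var_term v) * (p * x))) (mult_vec k (coords (p * x)))"
        unfolding k(2) by (rule coords_X[OF px(1) k(1)])
      also have "cong_vec \<dots> (mult_vec k (\<lambda>i. 0))" by (rule mult_vec_cong[OF k(1) px(2)])
      finally have "\<forall>i<\<mu>. coords (of_term (var_term v) * (p * x)) i \<in> J"
        by (simp add: cong_vec_def mult_vec_def)
      moreover have "of_term (var_term v) * (p * x) \<in> carrier (Kxc n \<mu> \<nu>)"
        by (rule poly_ring_mult[OF poly_ring_var[OF var(1)] px(1)])
      ultimately show ?thesis unfolding mult.assoc by (simp add: coords_kernel_def)
    qed
  qed
qed

lemma coords_generic_prebasis:
  assumes j: "j < \<nu>"
  shows "generic_prebasis \<mu> t b j \<in> coords_kernel"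
proof -
  obtain k q where kq: "k < n" "q < \<mu>" "b j = var_term (X k) + t q"
    using b_eq_var_t[OF j] by blast
  have "coords (generic_prebasis \<mu> t b j) i \<in> J" if i: "i < \<mu>" for i
  proof -
    have 1: "coords (of_term (b j)) i - cvar i j \<in> J"
    proof -
      have "coords (of_term (var_term (X k) + t q)) i - mm k i q \<in> J"
        using coords_X_t[OF kq(2,1) coords_Ord[OF t_Ord[OF kq(2)]]] i unfolding cong_vec_def by blast
      then show ?thesis unfolding kq(3) mm_border[OF i kq(2) j kq(3)[symmetric]] .
    qed
    have "coords (\<Sum>m<\<mu>. cvar m j * of_term (t m)) i = (\<Sum>m<\<mu>. cvar m j * coords (of_term (t m)) i :: 'k mpoly)"
      unfolding coords_sum by (intro sum.cong coords_mult_Kc cvar_Kc j of_term_t_Kxc t_Ord) auto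
    moreover have "(\<Sum>m<\<mu>. cvar m j * coords (of_term (t m)) i) - (\<Sum>m<\<mu>. cvar m j * Ord_unit (t m) i) \<in> J"
      unfolding sum_subtractf[symmetric] right_diff_distrib[symmetric]
      using coords_Ord[OF t_Ord] i unfolding cong_vec_def
      by (intro ideal_poly_sum[OF J] ideal_poly_mult[OF J] cvar_Kc j) auto
    moreover have "(\<Sum>m<\<mu>. cvar m j * Ord_unit (t m) i) = (\<Sum>m<\<mu>. if m = i then cvar i j else (0 :: 'k mpoly))"
      using t_inj i by (intro sum.cong) (auto simp: Ord_unit_def)
    ultimately have 2: "coords (\<Sum>m<\<mu>. cvar m j * of_term (t m)) i - cvar i j \<in> J"
      using i by simp
    show ?thesis
      unfolding generic_prebasis_def coords_diff using ideal_poly_diff[OF J 1 2] by simp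
  qed
  then show ?thesis using generic_prebasis_Kxc[OF j] by (simp add: coords_kernel_def)
qed

lemma J_coords_kernel: "J \<subseteq> coords_kernel"
proof
  fix q assume q: "q \<in> J"
  have qK: "q \<in> carrier (Kc \<mu> \<nu>)" by (rule subsetD[OF ideal_poly_subset[OF J] q])
  have "coords q i = q * Ord_unit 0 i" for i
    using coords_mult_Kc[OF qK poly_ring_one, of i] by (simp add: coords_one)
  then show "q \<in> coords_kernel"
    using q subsetD[OF Kc_Kxc qK] ideal_poly_zero[OF J] by (simp add: coords_kernel_def Ord_unit_def)
qed

text \<open>
  The coordinates of a combination of \<open>Ord\<close> are, modulo \<open>J\<close>, its coefficients.  They lie in \<open>J\<close> because the
  kernel of \<open>coords\<close> is an ideal that contains all the generators.
\<close>

lemma Ord_independent: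
  assumes a: "\<forall>s\<in>Ord. a s \<in> carrier (Kc \<mu> \<nu>)"
    and 0: "(\<Sum>s\<in>Ord. a s * of_term s) \<in> Idl\<^bsub>Kxc n \<mu> \<nu>\<^esub> (J \<union> generic_prebasis \<mu> t b ` {..<\<nu>})"
  shows "\<forall>s\<in>Ord. a s \<in> J"
proof
  fix s assume s: "s \<in> Ord"
  obtain i where i: "i < \<mu>" "s = t i" using Ord_eq_t[OF s] by blast
  have "Idl\<^bsub>Kxc n \<mu> \<nu>\<^esub> (J \<union> generic_prebasis \<mu> t b ` {..<\<nu>}) \<subseteq> coords_kernel"
    by (rule poly_genideal_minimal[OF ideal_coords_kernel])
      (use J_coords_kernel coords_generic_prebasis in blast)
  with 0 have 1: "coords (\<Sum>s\<in>Ord. a s * of_term s) i \<in> J"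
    using i(1) by (auto simp: coords_kernel_def)
  have "coords (\<Sum>s\<in>Ord. a s * of_term s) i = (\<Sum>u\<in>Ord. a u * coords (of_term u) i)"
    unfolding coords_sum by (intro sum.cong coords_mult_Kc of_term_t_Kxc bspec[OF a]) auto
  moreover have "(\<Sum>u\<in>Ord. a u * coords (of_term u) i) - (\<Sum>u\<in>Ord. a u * Ord_unit u i) \<in> J"
    unfolding sum_subtractf[symmetric] right_diff_distrib[symmetric]
    using coords_Ord i unfolding cong_vec_def
    by (intro ideal_poly_sum[OF J] ideal_poly_mult[OF J] bspec[OF a]) auto
  moreover have "(\<Sum>u\<in>Ord. a u * Ord_unit u i) = (\<Sum>u\<in>Ord. if u = s then a s else 0)"
    using i by (intro sum.cong) (auto simp: Ord_unit_def)
  ultimately have "coords (\<Sum>s\<in>Ord. a s * of_term s) i - a s \<in> J"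
    using s finite_Ord by simp
  from ideal_poly_diff[OF J 1 this] show "a s \<in> J" by simp
qed

end

end

section \<open>Reduction modulo an ideal\<close>

context labelled_terms
begin

text \<open>
  The set \<open>D\<close> of terms varies because the induction over the border has to keep track of which elements
  of \<open>Ord\<close> occur.
\<close>

definition spanned :: "'k::field mpoly set \<Rightarrow> indet set \<Rightarrow> pterm set \<Rightarrow> 'k mpoly set" where
  "spanned W V D = {p \<in> carrier (poly_ring (xvars n \<union> V)).
     \<exists>a. (\<forall>s\<in>D. a s \<in> carrier (poly_ring V)) \<and> p - (\<Sum>s\<in>D. a s * of_term s) \<in> W}"

context
  fixes W :: "'k::field mpoly set" and V :: "indet set"
  assumes W: "ideal W (poly_ring (xvars n \<union> V))"
begin

lemma spanned_carrier: "p \<in> spanned W V D \<Longrightarrow> p \<in> carrier (poly_ring (xvars n \<union> V))"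
  by (simp add: spanned_def)

lemma coeff_carrier: "q \<in> carrier (poly_ring V) \<Longrightarrow> q \<in> carrier (poly_ring (xvars n \<union> V))"
  using poly_ring_mono[of V "xvars n \<union> V"] by blast

lemma spanned_cong:
  assumes "p \<in> carrier (poly_ring (xvars n \<union> V))" "q \<in> spanned W V D" "p - q \<in> W"
  shows "p \<in> spanned W V D"
proof -
  from assms(2) obtain a where a: "\<forall>s\<in>D. a s \<in> carrier (poly_ring V)"
    "q - (\<Sum>s\<in>D. a s * of_term s) \<in> W" by (auto simp: spanned_def)
  have "p - (\<Sum>s\<in>D. a s * of_term s) \<in> W" by (rule ideal_poly_trans[OF W assms(3) a(2)])
  then show ?thesis using a(1) assms(1) by (auto simp: spanned_def)
qed

lemma spanned_zero: "0 \<in> spanned W V D"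
  using ideal_poly_zero[OF W] by (auto simp: spanned_def intro!: exI[of _ "\<lambda>_. 0"])

lemma spanned_add:
  assumes "p \<in> spanned W V D" "q \<in> spanned W V D"
  shows "p + q \<in> spanned W V D"
proof -
  from assms(1) obtain a where a: "\<forall>s\<in>D. a s \<in> carrier (poly_ring V)"
    "p - (\<Sum>s\<in>D. a s * of_term s) \<in> W" by (auto simp: spanned_def)
  from assms(2) obtain c where c: "\<forall>s\<in>D. c s \<in> carrier (poly_ring V)"
    "q - (\<Sum>s\<in>D. c s * of_term s) \<in> W" by (auto simp: spanned_def)
  have "p + q - (\<Sum>s\<in>D. (a s + c s) * of_term s)
    = (p - (\<Sum>s\<in>D. a s * of_term s)) + (q - (\<Sum>s\<in>D. c s * of_term s))"
    by (simp add: distrib_right sum.distrib)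
  also have "\<dots> \<in> W" by (rule ideal_poly_add[OF W a(2) c(2)])
  finally have "p + q - (\<Sum>s\<in>D. (a s + c s) * of_term s) \<in> W" .
  moreover have "\<forall>s\<in>D. a s + c s \<in> carrier (poly_ring V)" using a(1) c(1) by blast
  moreover have "p + q \<in> carrier (poly_ring (xvars n \<union> V))"
    by (intro poly_ring_add spanned_carrier[OF assms(1)] spanned_carrier[OF assms(2)])
  ultimately show ?thesis unfolding spanned_def
    by (intro CollectI conjI exI[where x = "\<lambda>s. a s + c s"])
qed

lemma spanned_mult:
  assumes r: "r \<in> carrier (poly_ring V)" and p: "p \<in> spanned W V D"
  shows "r * p \<in> spanned W V D"
proof -
  from p obtain a where a: "\<forall>s\<in>D. a s \<in> carrier (poly_ring V)"
    "p - (\<Sum>s\<in>D. a s * of_term s) \<in> W" by (auto simp: spanned_def)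
  have "r * p - (\<Sum>s\<in>D. (r * a s) * of_term s) = r * (p - (\<Sum>s\<in>D. a s * of_term s))"
    by (simp add: right_diff_distrib sum_distrib_left mult.assoc)
  also have "\<dots> \<in> W" by (rule ideal_poly_mult[OF W coeff_carrier[OF r] a(2)])
  finally have "r * p - (\<Sum>s\<in>D. (r * a s) * of_term s) \<in> W" .
  moreover have "\<forall>s\<in>D. r * a s \<in> carrier (poly_ring V)" using a(1) r by blast
  moreover have "r * p \<in> carrier (poly_ring (xvars n \<union> V))"
    by (intro poly_ring_mult spanned_carrier[OF p] coeff_carrier[OF r])
  ultimately show ?thesis unfolding spanned_def
    by (intro CollectI conjI exI[where x = "\<lambda>s. r * a s"])
qed

lemma spanned_sum: "(\<And>x. x \<in> A \<Longrightarrow> f x \<in> spanned W V D) \<Longrightarrow> sum f A \<in> spanned W V D"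
  by (induction A rule: infinite_finite_induct) (simp_all add: spanned_zero spanned_add)

lemma spanned_term:
  assumes "s \<in> D" "D \<subseteq> Ord"
  shows "of_term s \<in> spanned W V D"
proof -
  have fin: "finite D" using assms(2) finite_Ord by (rule finite_subset)
  have "(\<Sum>u\<in>D. (if u = s then 1 else 0) * of_term u) = (\<Sum>u\<in>D. if u = s then of_term s else (0 :: 'k mpoly))"
    by (intro sum.cong) auto
  then have "of_term s - (\<Sum>u\<in>D. (if u = s then 1 else 0) * of_term u) = (0 :: 'k mpoly)"
    using fin assms(1) by simp
  then have "of_term s - (\<Sum>u\<in>D. (if u = s then 1 else 0) * of_term u) \<in> W"
    using ideal_poly_zero[OF W] by (simp only:)
  moreover have "of_term s \<in> carrier (poly_ring (xvars n \<union> V))"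
    using Ord_terms[of s] assms by (intro poly_ring_of_term) (auto simp: terms_def)
  moreover have "\<forall>u\<in>D. (if u = s then 1 else 0) \<in> carrier (poly_ring V)" by simp
  ultimately show ?thesis unfolding spanned_def
    by (intro CollectI conjI exI[where x = "\<lambda>u. if u = s then 1 else 0"])
qed

lemma spanned_mono:
  assumes "D \<subseteq> D'" "D' \<subseteq> Ord"
  shows "spanned W V D \<subseteq> spanned W V D'"
proof
  fix p assume p: "p \<in> spanned W V D"
  then obtain a where a: "\<forall>s\<in>D. a s \<in> carrier (poly_ring V)"
    "p - (\<Sum>s\<in>D. a s * of_term s) \<in> W" by (auto simp: spanned_def)
  have "(\<Sum>s\<in>D. a s * of_term s) \<in> spanned W V D'"
    using assms a(1) by (intro spanned_sum spanned_mult spanned_term) auto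
  then show "p \<in> spanned W V D'" by (rule spanned_cong[OF spanned_carrier[OF p] _ a(2)])
qed

lemma spanned_var_mult:
  assumes p: "p \<in> spanned W V D" and k: "k < n"
    and step: "\<And>s. s \<in> D \<Longrightarrow> of_term (var_term (X k) + s) \<in> spanned W V D'"
  shows "of_term (var_term (X k)) * p \<in> spanned W V D'"
proof -
  obtain a where a: "\<forall>s\<in>D. a s \<in> carrier (poly_ring V)"
    "p - (\<Sum>s\<in>D. a s * of_term s) \<in> W" using p by (auto simp: spanned_def)
  have x: "of_term (var_term (X k)) \<in> carrier (poly_ring (xvars n \<union> V))"
    using k by (intro poly_ring_var) (auto simp: xvars_def)
  have "(\<Sum>s\<in>D. a s * of_term (var_term (X k) + s)) \<in> spanned W V D'"
    using a(1) by (intro spanned_sum spanned_mult step) auto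
  moreover have "(\<Sum>s\<in>D. a s * of_term (var_term (X k) + s)) = of_term (var_term (X k)) * (\<Sum>s\<in>D. a s * of_term s)"
    by (simp add: sum_distrib_left of_term_add mult.left_commute)
  moreover have "of_term (var_term (X k)) * p - of_term (var_term (X k)) * (\<Sum>s\<in>D. a s * of_term s) \<in> W"
    unfolding right_diff_distrib[symmetric] by (rule ideal_poly_mult[OF W x a(2)])
  moreover have "of_term (var_term (X k)) * p \<in> carrier (poly_ring (xvars n \<union> V))"
    by (rule poly_ring_mult[OF x spanned_carrier[OF p]])
  ultimately show ?thesis using spanned_cong by metis
qed

text \<open>
  Only the border terms have to be rewritten: a product of \<open>X k\<close> and an element of \<open>Ord\<close> never
  leaves \<open>Ord\<close> and its border.
\<close>

lemma Ord_spans: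
  assumes b: "\<And>j. j < \<nu> \<Longrightarrow> of_term (b j) \<in> spanned W V Ord"
    and p: "p \<in> carrier (poly_ring (xvars n \<union> V))"
  shows "p \<in> spanned W V Ord"
  using p
proof (induction rule: poly_ring_induct)
  case (const c)
  have "Poly_Mapping.single 0 c * of_term 0 \<in> spanned W V Ord"
    by (intro spanned_mult poly_ring_const spanned_term zero_Ord order_refl)
  then show ?case by (simp add: of_term_zero)
next
  case (add p q)
  then show ?case by (intro spanned_add)
next
  case (var v p)
  show ?case
  proof (cases "v \<in> V")
    case True
    show ?thesis by (rule spanned_mult[OF poly_ring_var[OF True] var.IH])
  next
    case False
    then obtain k where k: "k < n" "v = X k" using var.hyps(1) by (auto simp: xvars_def)
    have "of_term (var_term (X k) + s) \<in> spanned W V Ord" if s: "s \<in> Ord" for s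
    proof (rule var_t_cases[OF k(1) s])
      assume "var_term (X k) + s \<in> Ord"
      then show ?thesis by (intro spanned_term order_refl)
    next
      fix j assume "j < \<nu>" "var_term (X k) + s = b j"
      then show ?thesis using b by simp
    qed
    then show ?thesis unfolding k(2) by (rule spanned_var_mult[OF var.IH k(1)])
  qed
qed

end

end


section \<open>Elimination along the term ordering\<close>

locale labelled_terms_ordered = labelled_terms +
  fixes \<sigma> :: "pterm rel"
  assumes ordering: "term_ordering n \<sigma>"
begin

abbreviation less_sigma :: "pterm \<Rightarrow> pterm \<Rightarrow> bool" (infix \<open>\<prec>\<close> 50) where
  "s \<prec> u \<equiv> gt_term \<sigma> u s"

lemma less_trans: "s \<prec> u \<Longrightarrow> u \<prec> w \<Longrightarrow> s \<prec> w"
  using ordering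
  unfolding term_ordering_def linear_order_on_def partial_order_on_def preorder_on_def gt_term_def
  by (meson antisymD transD)

lemma less_var_mult:
  "s \<prec> u \<Longrightarrow> s \<in> terms n \<Longrightarrow> u \<in> terms n \<Longrightarrow> k < n \<Longrightarrow> var_term (X k) + s \<prec> var_term (X k) + u"
  using ordering terms_X[of k] unfolding term_ordering_def gt_term_def
  by (simp add: add.commute[of "var_term (X k)"])

lemma less_var: 
  assumes s: "s \<in> terms n" and k: "k < n"
  shows "s \<prec> var_term (X k) + s"
proof -
  have "(0 + s, var_term (X k) + s) \<in> \<sigma>"
    using ordering terms_X[OF k] s unfolding term_ordering_def by (metis terms_add_iff add_0)
  moreover have "s \<noteq> var_term (X k) + s"
  proof
    assume "s = var_term (X k) + s"
    then have "var_term (X k) = 0" by (metis add_cancel_left_left)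
    then show False using keys_var_term[of "X k"] by simp
  qed
  ultimately show ?thesis by (simp add: gt_term_def)
qed

text \<open>
  As the border is finite, the number of smaller border terms is a measure for the induction.
\<close>

lemma border_induct [consumes 1, case_names less]:
  assumes "j < \<nu>"
    and less: "\<And>j. j < \<nu> \<Longrightarrow> (\<And>r. r < \<nu> \<Longrightarrow> b r \<prec> b j \<Longrightarrow> P r) \<Longrightarrow> P j"
  shows "P j"
  using assms(1)
proof (induction "card {r. r < \<nu> \<and> b r \<prec> b j}" arbitrary: j rule: less_induct)
  case (less j)
  show ?case
  proof (rule assms(2)[OF less.prems])
    fix r assume r: "r < \<nu>" "b r \<prec> b j"
    have "{q. q < \<nu> \<and> b q \<prec> b r} \<subseteq> {q. q < \<nu> \<and> b q \<prec> b j}" using less_trans r by blast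
    moreover have "r \<notin> {q. q < \<nu> \<and> b q \<prec> b r}" by (simp add: gt_term_def)
    moreover have "r \<in> {q. q < \<nu> \<and> b q \<prec> b j}" using r by blast
    ultimately have "{q. q < \<nu> \<and> b q \<prec> b r} \<subset> {q. q < \<nu> \<and> b q \<prec> b j}" by blast
    then have "card {q. q < \<nu> \<and> b q \<prec> b r} < card {q. q < \<nu> \<and> b q \<prec> b j}"
      by (intro psubset_card_mono) auto
    then show "P r" using less.hyps r(1) by blast
  qed
qed

abbreviation L :: "'k::field mpoly set" where "L \<equiv> ideal_L \<mu> \<nu> t b \<sigma>"
abbreviation B :: "'k::field mpoly set" where "B \<equiv> ideal_B n \<mu> \<nu> t b"
abbreviation SC :: "indet set" where "SC \<equiv> S_corner \<mu> \<nu> \<eta> t b \<sigma>"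

definition J :: "'k::field mpoly set" where "J = L <+>\<^bsub>Kc \<mu> \<nu>\<^esub> B"

lemma L_gens: "{cvar i j |i j. i < \<mu> \<and> j < \<nu> \<and> C i j \<notin> S_all \<mu> \<nu> t b \<sigma>} \<subseteq> carrier (Kc \<mu> \<nu>)"
  using cvar_Kc by blast

lemma ideal_ideal_L: "ideal L (Kc \<mu> \<nu>)"
  unfolding ideal_L_def by (rule poly_genideal[OF L_gens])

lemma J_genideal: "J = Idl\<^bsub>Kc \<mu> \<nu>\<^esub> (L \<union> B)"
  unfolding J_def by (rule ring.union_genideal[OF ring_poly_ring ideal_ideal_L ideal_ideal_B, symmetric])

lemma LB_Kc: "L \<union> B \<subseteq> carrier (Kc \<mu> \<nu>)"
  using ideal_poly_subset[OF ideal_ideal_L] ideal_poly_subset[OF ideal_ideal_B] by blast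

lemma ideal_J: "ideal J (Kc \<mu> \<nu>)"
  unfolding J_genideal by (rule poly_genideal[OF LB_Kc])

lemma L_B_J: "L \<subseteq> J" "B \<subseteq> J"
  unfolding J_genideal using poly_genideal_self[OF LB_Kc] by blast+

lemma cvar_L: "i < \<mu> \<Longrightarrow> j < \<nu> \<Longrightarrow> \<not> t i \<prec> b j \<Longrightarrow> cvar i j \<in> L"
  unfolding ideal_L_def by (rule subsetD[OF poly_genideal_self[OF L_gens]]) (auto simp: S_all_def)

lemma cvar_KS: "i < \<mu> \<Longrightarrow> j < \<eta> \<Longrightarrow> t i \<prec> b j \<Longrightarrow> cvar i j \<in> carrier (poly_ring SC)"
  unfolding cvar_def using eta_le by (intro poly_ring_var) (auto simp: S_corner_def S_all_def)

lemma SC_cvars: "SC \<subseteq> cvars \<mu> \<nu>"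
  by (auto simp: S_corner_def S_all_def cvars_def)

lemma KS_Kc: "carrier (poly_ring SC) \<subseteq> carrier (Kc \<mu> \<nu>)"
  by (rule poly_ring_mono[OF SC_cvars])

definition eliminable :: "'k::field mpoly set" where
  "eliminable = {p \<in> carrier (Kc \<mu> \<nu>). \<exists>q\<in>carrier (poly_ring SC). p - q \<in> J}"

lemma eliminableI: "p \<in> carrier (Kc \<mu> \<nu>) \<Longrightarrow> q \<in> carrier (poly_ring SC) \<Longrightarrow> p - q \<in> J \<Longrightarrow> p \<in> eliminable"
  by (auto simp: eliminable_def)

lemma eliminable_J: "p \<in> J \<Longrightarrow> p \<in> eliminable"
  using ideal_poly_subset[OF ideal_J] by (intro eliminableI[of p 0]) auto

lemma eliminable_KS: "p \<in> carrier (poly_ring SC) \<Longrightarrow> p \<in> eliminable"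
  using KS_Kc ideal_poly_zero[OF ideal_J] by (intro eliminableI[of p p]) auto

lemma eliminable_cong:
  assumes "p \<in> carrier (Kc \<mu> \<nu>)" "q \<in> eliminable" "p - q \<in> J"
  shows "p \<in> eliminable"
  using assms ideal_poly_trans[OF ideal_J] unfolding eliminable_def by blast

lemma eliminable_add:
  assumes "p \<in> eliminable" "q \<in> eliminable"
  shows "p + q \<in> eliminable"
proof -
  obtain p' q' where "p' \<in> carrier (poly_ring SC)" "p - p' \<in> J" "q' \<in> carrier (poly_ring SC)" "q - q' \<in> J"
    and "p \<in> carrier (Kc \<mu> \<nu>)" "q \<in> carrier (Kc \<mu> \<nu>)"
    using assms by (auto simp: eliminable_def)
  then show ?thesis
    using ideal_poly_add[OF ideal_J, of "p - p'" "q - q'"]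
    by (intro eliminableI[of "p + q" "p' + q'"]) (auto simp: add_diff_add)
qed

lemma eliminable_mult:
  assumes "p \<in> eliminable" "q \<in> eliminable"
  shows "p * q \<in> eliminable"
proof -
  obtain p' q' where *: "p' \<in> carrier (poly_ring SC)" "p - p' \<in> J" "q' \<in> carrier (poly_ring SC)" "q - q' \<in> J"
    and pq: "p \<in> carrier (Kc \<mu> \<nu>)" "q \<in> carrier (Kc \<mu> \<nu>)"
    using assms by (auto simp: eliminable_def)
  have "p * q - p' * q' = p * (q - q') + q' * (p - p')" by (simp add: algebra_simps)
  also have "\<dots> \<in> J"
    using * KS_Kc by (intro ideal_poly_add[OF ideal_J] ideal_poly_mult[OF ideal_J] pq) auto
  finally show ?thesis using * pq by (intro eliminableI[of "p * q" "p' * q'"]) auto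
qed

lemma eliminable_sum: "(\<And>x. x \<in> A \<Longrightarrow> f x \<in> eliminable) \<Longrightarrow> sum f A \<in> eliminable"
  by (induction A rule: infinite_finite_induct)
    (simp_all add: eliminable_add eliminable_KS)

text \<open>
  Both matrix products are applied to the column of \<open>t p\<close>.  First \<open>X l\<close>, then \<open>X k\<close>: this passes through the border
  term \<open>b m\<close>, whose column consists of coefficients.  First \<open>X k\<close>, then \<open>X l\<close>: this passes through \<open>t i'\<close> in
  \<open>Ord\<close> and ends at the column of \<open>b j\<close>.
\<close>

lemma noncorner_relation:
  assumes "k < n" "l < n" "m < \<nu>" "p < \<mu>" "i' < \<mu>" "j < \<nu>" "i < \<mu>"
    and "b m = var_term (X l) + t p" "t i' = var_term (X k) + t p" "b j = var_term (X l) + t i'"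
  shows "cvar i j - (\<Sum>q<\<mu>. mm k i q * cvar q m) \<in> B"
proof -
  have 1: "(\<Sum>q<\<mu>. mm k i q * mm l q p) = (\<Sum>q<\<mu>. mm k i q * cvar q m :: 'a mpoly)"
    by (intro sum.cong refl arg_cong2[where f = "(*)"] mm_border) (use assms in auto)
  have "mm k q p = (if q = i' then 1 else (0 :: 'a mpoly))" if "q < \<mu>" for q
    using mm_inside[of q p k] that assms(4,5) t_Ord[of i'] t_inj[of q i'] unfolding assms(9)[symmetric]
    by simp
  then have "(\<Sum>q<\<mu>. mm l i q * mm k q p) = (\<Sum>q<\<mu>. if q = i' then mm l i i' else (0 :: 'a mpoly))"
    by (intro sum.cong) auto
  also have "\<dots> = mm l i i'" using assms(5) by simp
  also have "\<dots> = cvar i j" by (rule mm_border) (use assms in auto)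
  finally have 2: "(\<Sum>q<\<mu>. mm l i q * mm k q p) = (cvar i j :: 'a mpoly)" .
  have "(\<Sum>q<\<mu>. mm l i q * mm k q p) - (\<Sum>q<\<mu>. mm k i q * mm l q p) \<in> (B :: 'a mpoly set)"
    by (rule mm_commute[OF assms(7,4,2,1)])
  then show ?thesis unfolding 1 2 .
qed

text \<open>
  In the sum of \<open>noncorner_relation\<close> a summand with \<open>t q\<close> not below \<open>b m\<close> lies in \<open>L\<close>.  In the others
  \<open>X k * t q\<close> is below \<open>X k * b m = b j\<close>, so the matrix entry is 0, 1 or a coefficient of a smaller border
  term; \<open>b m\<close> itself is smaller than \<open>b j\<close> as well.
\<close>

lemma cvar_eliminable:
  assumes "j < \<nu>" "i < \<mu>"
  shows "(cvar i j :: 'k::field mpoly) \<in> eliminable"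
  using assms
proof (induction j arbitrary: i rule: border_induct)
  case (less j)
  show ?case
  proof (cases "t i \<prec> b j")
    case False
    then show ?thesis using cvar_L less.prems less.hyps L_B_J by (intro eliminable_J) blast
  next
    case True
    show ?thesis
    proof (rule noncorner_border_cases[OF less.hyps])
      assume "j < \<eta>"
      then show ?thesis using True less.prems by (intro eliminable_KS cvar_KS)
    next
      fix k l m p i'
      assume *: "k < n" "l < n" "m < \<nu>" "p < \<mu>" "i' < \<mu>" "b j = var_term (X k) + b m"
        "b m = var_term (X l) + t p" "t i' = var_term (X k) + t p" "b j = var_term (X l) + t i'"
      have bm: "b m \<prec> b j" unfolding *(6) by (rule less_var[OF b_terms[OF *(3)] *(1)])
      have "mm k i q * cvar q m \<in> (eliminable :: 'k mpoly set)" if q: "q < \<mu>" for q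
      proof (cases "t q \<prec> b m")
        case True
        have "(mm k i q :: 'k mpoly) \<in> eliminable"
        proof (rule var_t_cases[OF *(1) t_Ord[OF q]])
          assume in_Ord: "var_term (X k) + t q \<in> Ord"
          show ?thesis unfolding mm_inside[OF less.prems q in_Ord] by (rule eliminable_KS) simp
        next
          fix r assume r: "r < \<nu>" "var_term (X k) + t q = b r"
          have "b r \<prec> b j"
            unfolding r(2)[symmetric] *(6)
            by (rule less_var_mult[OF True Ord_terms[OF t_Ord[OF q]] b_terms[OF *(3)] *(1)])
          from less.IH[OF r(1) this less.prems]
          show ?thesis unfolding mm_border[OF less.prems q r] .
        qed
        then show ?thesis by (rule eliminable_mult[OF _ less.IH[OF *(3) bm q]])
      next
        case False
        have "(cvar q m :: 'k mpoly) \<in> J" using cvar_L[OF q *(3) False] L_B_J by blast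
        then show ?thesis
          by (intro eliminable_J ideal_poly_mult[OF ideal_J] mm_Kc *(1) less.prems q)
      qed
      then have "(\<Sum>q<\<mu>. mm k i q * cvar q m) \<in> (eliminable :: 'k mpoly set)" by (intro eliminable_sum) simp
      moreover have "cvar i j - (\<Sum>q<\<mu>. mm k i q * cvar q m) \<in> (J :: 'k mpoly set)"
        using noncorner_relation[OF *(1-5) less.hyps less.prems *(7-9)] L_B_J by blast
      ultimately show ?thesis
        by (rule eliminable_cong[OF cvar_Kc[OF less.prems less.hyps]])
    qed
  qed
qed

lemma Kc_eliminable:
  fixes p :: "'k::field mpoly"
  assumes "p \<in> carrier (Kc \<mu> \<nu>)"
  shows "\<exists>q\<in>carrier (poly_ring SC). p - q \<in> J"
proof -
  have "p \<in> eliminable"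
    using assms
  proof (induction rule: poly_ring_induct)
    case (const c)
    show ?case by (rule eliminable_KS) simp
  next
    case (add p q)
    show ?case by (rule eliminable_add[OF add(3,4)])
  next
    case (var v p)
    then obtain i j where "i < \<mu>" "j < \<nu>" "v = C i j" by (auto simp: cvars_def)
    then have "(of_term (var_term v) :: 'k mpoly) \<in> eliminable" using cvar_eliminable unfolding cvar_def by blast
    then show ?case by (rule eliminable_mult[OF _ var.IH])
  qed
  then show ?thesis by (simp add: eliminable_def)
qed

end

section \<open>The two universal families\<close>

context labelled_terms_ordered
begin

abbreviation G :: "'k::field mpoly set" where "G \<equiv> ideal_G n \<mu> \<nu> \<eta> t b \<sigma>"
abbreviation UG :: "'k::field mpoly set" where "UG \<equiv> ideal_UG n \<mu> \<nu> \<eta> t b \<sigma>"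
abbreviation g :: "nat \<Rightarrow> 'k::field mpoly" where "g \<equiv> generic_prebasis \<mu> t b"
abbreviation g' :: "nat \<Rightarrow> 'k::field mpoly" where "g' \<equiv> generic_prebasis_star \<mu> t b \<sigma>"

definition W :: "'k::field mpoly set" where
  "W = Idl\<^bsub>Kxc n \<mu> \<nu>\<^esub> (L \<union> B \<union> g ` {..<\<nu>})"

lemma W_gens: "L \<union> B \<union> g ` {..<\<nu>} \<subseteq> carrier (Kxc n \<mu> \<nu>)"
  using LB_Kc Kc_Kxc generic_prebasis_Kxc by blast

lemma ideal_W: "ideal W (Kxc n \<mu> \<nu>)"
  unfolding W_def by (rule poly_genideal[OF W_gens])

lemma gens_W: "L \<subseteq> W" "B \<subseteq> W" "j < \<nu> \<Longrightarrow> g j \<in> W"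
  unfolding W_def using poly_genideal_self[OF W_gens] by blast+

lemma J_W: "J \<subseteq> W"
proof -
  have "L <+>\<^bsub>Kc \<mu> \<nu>\<^esub> B \<subseteq> W"
    using gens_W(1,2) ideal_poly_add[OF ideal_W] by (auto simp: AbelCoset.set_add_def' )
  then show ?thesis unfolding J_def .
qed

lemma W_subset: "W \<subseteq> Idl\<^bsub>Kxc n \<mu> \<nu>\<^esub> (J \<union> g ` {..<\<nu>})"
proof -
  have *: "J \<union> g ` {..<\<nu>} \<subseteq> carrier (Kxc n \<mu> \<nu>)"
    using ideal_poly_subset[OF ideal_J] Kc_Kxc generic_prebasis_Kxc by blast
  show ?thesis
    unfolding W_def
    by (rule poly_genideal_minimal[OF poly_genideal[OF *]])
      (use poly_genideal_self[OF *] L_B_J in blast)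
qed

lemma independent_mod_W:
  assumes "\<forall>s\<in>Ord. a s \<in> carrier (Kc \<mu> \<nu>)" "(\<Sum>s\<in>Ord. a s * of_term s) \<in> W"
  shows "\<forall>s\<in>Ord. a s \<in> J"
  using Ord_independent[OF ideal_J L_B_J(2) assms(1)] assms(2) W_subset by blast

lemma spans_mod_W:
  fixes p :: "'k::field mpoly"
  assumes "p \<in> carrier (Kxc n \<mu> \<nu>)"
  shows "p \<in> spanned W (cvars \<mu> \<nu>) Ord"
proof (rule Ord_spans[OF ideal_W _ assms])
  fix j assume j: "j < \<nu>"
  have "(\<Sum>i<\<mu>. cvar i j * of_term (t i)) \<in> spanned W (cvars \<mu> \<nu>) Ord"
    by (intro spanned_sum[OF ideal_W] spanned_mult[OF ideal_W] cvar_Kc j spanned_term[OF ideal_W] t_Ord)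
      simp_all
  moreover have "of_term (b j) - (\<Sum>i<\<mu>. cvar i j * of_term (t i)) \<in> (W :: 'k mpoly set)"
    using gens_W(3)[OF j] by (simp add: generic_prebasis_def)
  ultimately show "(of_term (b j) :: 'k mpoly) \<in> spanned W (cvars \<mu> \<nu>) Ord"
    by (rule spanned_cong[OF ideal_W of_term_b_Kxc[OF j]])
qed

lemma KxS_Kxc: "carrier (KxS n \<mu> \<nu> \<eta> t b \<sigma>) \<subseteq> carrier (Kxc n \<mu> \<nu>)"
  by (rule poly_ring_mono) (use SC_cvars in blast)

lemma KS_KxS: "carrier (poly_ring SC) \<subseteq> carrier (KxS n \<mu> \<nu> \<eta> t b \<sigma>)"
  by (rule poly_ring_mono) simp

lemma of_term_KxS: "s \<in> terms n \<Longrightarrow> of_term s \<in> carrier (KxS n \<mu> \<nu> \<eta> t b \<sigma>)"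
  by (intro poly_ring_of_term) (auto simp: terms_def)

lemma G_eq: "G = J \<inter> carrier (poly_ring SC)"
  by (simp add: ideal_G_def J_def)

lemma ideal_ideal_G: "ideal G (poly_ring SC)"
  unfolding G_eq by (rule ideal_poly_contract[OF ideal_J SC_cvars])

lemma star_KxS:
  assumes "j < \<eta>"
  shows "g' j \<in> carrier (KxS n \<mu> \<nu> \<eta> t b \<sigma>)"
  unfolding generic_prebasis_star_def
  using assms eta_le
  by (intro poly_ring_diff poly_ring_sum poly_ring_mult of_term_KxS b_terms Ord_terms t_Ord
      subsetD[OF KS_KxS] cvar_KS) auto

lemma UG_gens: "G \<union> g' ` {..<\<eta>} \<subseteq> carrier (KxS n \<mu> \<nu> \<eta> t b \<sigma>)"
  using ideal_poly_subset[OF ideal_ideal_G] KS_KxS star_KxS by blast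

lemma ideal_ideal_UG: "ideal UG (KxS n \<mu> \<nu> \<eta> t b \<sigma>)"
  unfolding ideal_UG_def by (rule poly_genideal[OF UG_gens])

lemma gens_UG: "G \<subseteq> UG" "j < \<eta> \<Longrightarrow> g' j \<in> UG"
  unfolding ideal_UG_def using poly_genideal_self[OF UG_gens] by blast+

text \<open>
  The generic and the truncated polynomial of a border term differ by terms whose coefficient is a
  generator of \<open>L\<close>.
\<close>

lemma star_W:
  assumes "j < \<eta>"
  shows "(g' j :: 'k::field mpoly) \<in> W"
proof -
  have j: "j < \<nu>" using assms eta_le by simp
  have "(\<Sum>i<\<mu>. cvar i j * of_term (t i)) = (\<Sum>i | i < \<mu> \<and> t i \<prec> b j. cvar i j * of_term (t i))
    + (\<Sum>i | i < \<mu> \<and> \<not> t i \<prec> b j. cvar i j * of_term (t i) :: 'k mpoly)"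
    by (subst sum.union_disjoint[symmetric]) (auto intro!: sum.cong)
  then have "g' j = g j + (\<Sum>i | i < \<mu> \<and> \<not> t i \<prec> b j. of_term (t i) * cvar i j :: 'k mpoly)"
    by (simp add: generic_prebasis_star_def generic_prebasis_def mult.commute[of "of_term _"])
  also have "\<dots> \<in> W"
    using cvar_L j gens_W(1)
    by (intro ideal_poly_add[OF ideal_W] gens_W(3) j ideal_poly_sum[OF ideal_W]
        ideal_poly_mult[OF ideal_W] of_term_t_Kxc t_Ord) auto
  finally show ?thesis .
qed

lemma UG_W: "UG \<subseteq> W \<inter> carrier (KxS n \<mu> \<nu> \<eta> t b \<sigma>)"
  unfolding ideal_UG_def
proof (rule poly_genideal_minimal)
  show "ideal (W \<inter> carrier (KxS n \<mu> \<nu> \<eta> t b \<sigma>)) (KxS n \<mu> \<nu> \<eta> t b \<sigma>)"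
    by (rule ideal_poly_contract[OF ideal_W]) (use SC_cvars in blast)
  show "G \<union> g' ` {..<\<eta>} \<subseteq> W \<inter> carrier (KxS n \<mu> \<nu> \<eta> t b \<sigma>)"
    using UG_gens G_eq J_W star_W by blast
qed

text \<open>
  For a corner this is the polynomial \<open>g' j\<close>.  Otherwise \<open>b j = X k * b m\<close>, and multiplying the expansion of
  \<open>b m\<close> by \<open>X k\<close> gives terms below \<open>b j\<close>, each in \<open>Ord\<close> or in the border.  Recording that only smaller terms
  occur is what makes the induction hypothesis applicable to the latter.
\<close>

lemma border_below:
  assumes "j < \<nu>"
  shows "(of_term (b j) :: 'k::field mpoly) \<in> spanned UG SC {s \<in> Ord. s \<prec> b j}"
  using assms
proof (induction rule: border_induct)
  case (less j)
  show ?case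
  proof (rule noncorner_border_cases[OF less.hyps])
    assume j: "j < \<eta>"
    have "(\<Sum>i | i < \<mu> \<and> t i \<prec> b j. cvar i j * of_term (t i) :: 'k mpoly) \<in> spanned UG SC {s \<in> Ord. s \<prec> b j}"
      using t_Ord j
      by (intro spanned_sum[OF ideal_ideal_UG] spanned_mult[OF ideal_ideal_UG] cvar_KS spanned_term[OF ideal_ideal_UG]) auto
    moreover have "of_term (b j) - (\<Sum>i | i < \<mu> \<and> t i \<prec> b j. cvar i j * of_term (t i)) \<in> (UG :: 'k mpoly set)"
      using gens_UG(2)[OF j] by (simp add: generic_prebasis_star_def)
    ultimately show ?thesis
      by (rule spanned_cong[OF ideal_ideal_UG of_term_KxS[OF b_terms[OF less.hyps]]])
  next
    fix k m
    assume *: "k < n" "m < \<nu>" "b j = var_term (X k) + b m"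
    have bm: "b m \<prec> b j" unfolding *(3) by (rule less_var[OF b_terms[OF *(2)] *(1)])
    have "(of_term (var_term (X k) + s) :: 'k mpoly) \<in> spanned UG SC {s \<in> Ord. s \<prec> b j}"
      if s: "s \<in> {s \<in> Ord. s \<prec> b m}" for s
    proof -
      have sO: "s \<in> Ord" and "s \<prec> b m" using s by auto
      then have sj: "var_term (X k) + s \<prec> b j"
        unfolding *(3) using less_var_mult[OF _ Ord_terms[OF sO] b_terms[OF *(2)] *(1)] by blast
      show ?thesis
      proof (rule var_t_cases[OF *(1) sO])
        assume "var_term (X k) + s \<in> Ord"
        then show ?thesis using sj by (intro spanned_term[OF ideal_ideal_UG]) auto
      next
        fix r assume r: "r < \<nu>" "var_term (X k) + s = b r"
        have "{s \<in> Ord. s \<prec> b r} \<subseteq> {s \<in> Ord. s \<prec> b j}"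
          using sj less_trans unfolding r(2) by blast
        from spanned_mono[OF ideal_ideal_UG this] less.IH[OF r(1)] sj
        show ?thesis unfolding r(2) by blast
      qed
    qed
    from spanned_var_mult[OF ideal_ideal_UG less.IH[OF *(2) bm] *(1) this]
    show ?thesis unfolding *(3) of_term_add .
  qed
qed

lemma spans_mod_UG:
  fixes p :: "'k::field mpoly"
  assumes "p \<in> carrier (KxS n \<mu> \<nu> \<eta> t b \<sigma>)"
  shows "p \<in> spanned UG SC Ord"
  by (rule Ord_spans[OF ideal_ideal_UG _ assms])
    (rule subsetD[OF spanned_mono[OF ideal_ideal_UG] border_below], auto)

text \<open>
  Part (c).  The expansion of \<open>p\<close> modulo \<open>UG\<close> has coefficients in \<open>K[S]\<close>; if \<open>p\<close> is in \<open>W\<close>, independence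
  modulo \<open>W\<close> puts them into \<open>J\<close> and so into \<open>G\<close>.
\<close>

lemma UG_eq: "(UG :: 'k::field mpoly set) = W \<inter> carrier (KxS n \<mu> \<nu> \<eta> t b \<sigma>)"
proof
  show "W \<inter> carrier (KxS n \<mu> \<nu> \<eta> t b \<sigma>) \<subseteq> (UG :: 'k mpoly set)"
  proof
    fix p :: "'k mpoly" assume "p \<in> W \<inter> carrier (KxS n \<mu> \<nu> \<eta> t b \<sigma>)"
    then have p: "p \<in> carrier (KxS n \<mu> \<nu> \<eta> t b \<sigma>)" "p \<in> W" by auto
    obtain a where a: "\<forall>s\<in>Ord. a s \<in> carrier (poly_ring SC)" "p - (\<Sum>s\<in>Ord. a s * of_term s) \<in> UG"
      using spans_mod_UG[OF p(1)] by (auto simp: spanned_def)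
    have "(\<Sum>s\<in>Ord. a s * of_term s) - p \<in> W"
      using ideal_poly_sym[OF ideal_W] a(2) UG_W by blast
    from ideal_poly_add[OF ideal_W this p(2)] have "(\<Sum>s\<in>Ord. a s * of_term s) \<in> W" by simp
    then have "\<forall>s\<in>Ord. a s \<in> J" using a(1) KS_Kc by (intro independent_mod_W) auto
    then have "\<forall>s\<in>Ord. a s \<in> UG" using a(1) G_eq gens_UG(1) by blast
    then have "(\<Sum>s\<in>Ord. of_term s * a s) \<in> UG"
      by (intro ideal_poly_sum[OF ideal_ideal_UG] ideal_poly_mult[OF ideal_ideal_UG] of_term_KxS Ord_terms) auto
    then have "(\<Sum>s\<in>Ord. a s * of_term s) \<in> UG" by (simp add: mult.commute)
    from ideal_poly_add[OF ideal_ideal_UG a(2) this] show "p \<in> UG" by simp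
  qed
qed (rule UG_W)

lemma presents_B_mod_L:
  "presents (cvars \<mu> \<nu>) J (class_B_mod_L n \<mu> \<nu> t b \<sigma>) (ring_B_mod_L n \<mu> \<nu> t b \<sigma> :: 'k::field mpoly set set ring)"
  and ideal_Lbar_B: "ideal (Lbar_B n \<mu> \<nu> t b \<sigma>) (ring_B n \<mu> \<nu> t b :: 'k mpoly set ring)"
proof -
  note * = presents_quot_genideal[OF presents_quot[OF ideal_ideal_B] ideal_ideal_B ideal_poly_subset[OF ideal_ideal_L]]
  have J: "J = Idl\<^bsub>Kc \<mu> \<nu>\<^esub> (B \<union> L :: 'k mpoly set)" unfolding J_genideal by (simp only: Un_commute)
  show "presents (cvars \<mu> \<nu>) J (class_B_mod_L n \<mu> \<nu> t b \<sigma>) (ring_B_mod_L n \<mu> \<nu> t b \<sigma> :: 'k mpoly set set ring)"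
    using *(1)
    by (simp add: class_B_mod_L_def[abs_def] class_B_def[abs_def] ring_B_mod_L_def ring_B_def Lbar_B_def J)
  show "ideal (Lbar_B n \<mu> \<nu> t b \<sigma>) (ring_B n \<mu> \<nu> t b :: 'k mpoly set ring)"
    using *(2) by (simp add: class_B_def[abs_def] ring_B_def Lbar_B_def)
qed

lemma presents_B: "presents (cvars \<mu> \<nu>) B (class_B n \<mu> \<nu> t b) (ring_B n \<mu> \<nu> t b)"
  using presents_quot[OF ideal_ideal_B] by (simp add: class_B_def[abs_def] ring_B_def)

lemma U_gens: "B \<union> g ` {..<\<nu>} \<subseteq> carrier (Kxc n \<mu> \<nu>)"
  using W_gens by blast

lemma ideal_ideal_U: "ideal (ideal_U n \<mu> \<nu> t b) (Kxc n \<mu> \<nu>)"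
  unfolding ideal_U_def by (rule poly_genideal[OF U_gens])

lemma presents_U: "presents (xvars n \<union> cvars \<mu> \<nu>) (ideal_U n \<mu> \<nu> t b) (class_U n \<mu> \<nu> t b) (ring_U n \<mu> \<nu> t b)"
  using presents_quot[OF ideal_ideal_U] by (simp add: class_U_def[abs_def] ring_U_def)

text \<open>
  The two ways of building \<open>U\<close> modulo \<open>L\<close>, by one quotient or by two, have the same relations.
\<close>

lemma W_eq: "W = Idl\<^bsub>Kxc n \<mu> \<nu>\<^esub> (ideal_U n \<mu> \<nu> t b \<union> L)"
proof
  have *: "ideal_U n \<mu> \<nu> t b \<union> L \<subseteq> carrier (Kxc n \<mu> \<nu>)"
    using W_gens ideal_poly_subset[OF ideal_ideal_U] by blast
  have U: "B \<union> g ` {..<\<nu>} \<subseteq> ideal_U n \<mu> \<nu> t b"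
    unfolding ideal_U_def by (rule poly_genideal_self[OF U_gens])
  show "W \<subseteq> Idl\<^bsub>Kxc n \<mu> \<nu>\<^esub> (ideal_U n \<mu> \<nu> t b \<union> L)"
    unfolding W_def
    by (rule poly_genideal_minimal[OF poly_genideal[OF *]]) (use poly_genideal_self[OF *] U in blast)
  have "ideal_U n \<mu> \<nu> t b \<subseteq> W"
    unfolding ideal_U_def by (rule poly_genideal_minimal[OF ideal_W]) (use gens_W in blast)
  then show "Idl\<^bsub>Kxc n \<mu> \<nu>\<^esub> (ideal_U n \<mu> \<nu> t b \<union> L) \<subseteq> W"
    by (intro poly_genideal_minimal[OF ideal_W]) (use gens_W in blast)
qed

lemma presents_U_mod_L:
  "presents (xvars n \<union> cvars \<mu> \<nu>) W (class_U_mod_L n \<mu> \<nu> t b \<sigma>) (ring_U_mod_L n \<mu> \<nu> t b \<sigma> :: 'k::field mpoly set set ring)"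
  and ideal_Lbar_U: "ideal (Lbar_U n \<mu> \<nu> t b \<sigma>) (ring_U n \<mu> \<nu> t b :: 'k mpoly set ring)"
proof -
  have "L \<subseteq> carrier (Kxc n \<mu> \<nu>)" using W_gens by blast
  note * = presents_quot_genideal[OF presents_quot[OF ideal_ideal_U] ideal_ideal_U this]
  show "presents (xvars n \<union> cvars \<mu> \<nu>) W (class_U_mod_L n \<mu> \<nu> t b \<sigma>) (ring_U_mod_L n \<mu> \<nu> t b \<sigma> :: 'k mpoly set set ring)"
    using *(1)
    by (simp add: class_U_mod_L_def[abs_def] class_U_def[abs_def] ring_U_mod_L_def ring_U_def Lbar_U_def W_eq)
  show "ideal (Lbar_U n \<mu> \<nu> t b \<sigma>) (ring_U n \<mu> \<nu> t b :: 'k mpoly set ring)"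
    using *(2) by (simp add: class_U_def[abs_def] ring_U_def Lbar_U_def)
qed

lemma presents_G: "presents SC G (\<lambda>p. G +>\<^bsub>poly_ring SC\<^esub> p) (ring_G n \<mu> \<nu> \<eta> t b \<sigma>)"
  using presents_quot[OF ideal_ideal_G] by (simp add: ring_G_def)

lemma presents_UG: "presents (xvars n \<union> SC) UG (class_UG n \<mu> \<nu> \<eta> t b \<sigma>) (ring_UG n \<mu> \<nu> \<eta> t b \<sigma>)"
  using presents_quot[OF ideal_ideal_UG] by (simp add: class_UG_def[abs_def] ring_UG_def)

lemma B_to_U_class:
  fixes p :: "'k::field mpoly"
  assumes "p \<in> carrier (Kc \<mu> \<nu>)"
  shows "B_to_U n \<mu> \<nu> t b (class_B n \<mu> \<nu> t b p) = class_U n \<mu> \<nu> t b p"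
proof -
  have "B \<subseteq> ideal_U n \<mu> \<nu> t b"
    unfolding ideal_U_def using poly_genideal_self[OF U_gens] by blast
  then have "induced (Kxc n \<mu> \<nu>) (ideal_U n \<mu> \<nu> t b) id (B +>\<^bsub>Kc \<mu> \<nu>\<^esub> p) = ideal_U n \<mu> \<nu> t b +>\<^bsub>Kxc n \<mu> \<nu>\<^esub> id p"
    using assms
    by (intro induced_class[OF ideal_ideal_B ideal_ideal_U id_poly_ring_hom]) auto
  then show ?thesis by (simp add: B_to_U_def class_B_def class_U_def)
qed

text \<open>
  The \<open>induced\<close> map is given by representatives only because \<open>B_to_U\<close> maps the image of \<open>L\<close> in \<open>B\<close> into
  the ideal that \<open>L\<close> generates in \<open>U\<close>.
\<close>

lemma B_mod_L_to_U_mod_L_class: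
  fixes p :: "'k::field mpoly"
  assumes p: "p \<in> carrier (Kc \<mu> \<nu>)"
  shows "induced (ring_U n \<mu> \<nu> t b) (Lbar_U n \<mu> \<nu> t b \<sigma>) (B_to_U n \<mu> \<nu> t b) (class_B_mod_L n \<mu> \<nu> t b \<sigma> p)
    = class_U_mod_L n \<mu> \<nu> t b \<sigma> p"
proof -
  have hom: "B_to_U n \<mu> \<nu> t b \<in> Ring.ring_hom (ring_B n \<mu> \<nu> t b) (ring_U n \<mu> \<nu> t b :: 'k mpoly set ring)"
    by (rule ring_hom_between_presented[OF presents_B presents_U _ B_to_U_class]) simp
  interpret hom: ring_hom_ring "ring_B n \<mu> \<nu> t b" "ring_U n \<mu> \<nu> t b :: 'k mpoly set ring" "B_to_U n \<mu> \<nu> t b"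
    using hom presentsD(1)[OF presents_B] presentsD(1)[OF presents_U]
    by (intro ring_hom_ringI2) (auto dest: cring.axioms)
  have LB: "class_B n \<mu> \<nu> t b ` L \<subseteq> carrier (ring_B n \<mu> \<nu> t b :: 'k mpoly set ring)"
    using presentsD(5)[OF presents_B] LB_Kc by blast
  have LU: "class_U n \<mu> \<nu> t b ` L \<subseteq> carrier (ring_U n \<mu> \<nu> t b :: 'k mpoly set ring)"
    using presentsD(5)[OF presents_U] W_gens by blast
  have "(Lbar_B n \<mu> \<nu> t b \<sigma> :: 'k mpoly set set)
      \<subseteq> {x \<in> carrier (ring_B n \<mu> \<nu> t b). B_to_U n \<mu> \<nu> t b x \<in> Lbar_U n \<mu> \<nu> t b \<sigma>}"
    unfolding Lbar_B_def
  proof (rule hom.R.genideal_minimal[OF hom.ideal_vimage[OF ideal_Lbar_U]])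
    have "B_to_U n \<mu> \<nu> t b (class_B n \<mu> \<nu> t b q) \<in> Lbar_U n \<mu> \<nu> t b \<sigma>" if q: "q \<in> L" for q :: "'k mpoly"
      using B_to_U_class[of q] q LB_Kc hom.S.genideal_self[OF LU] unfolding Lbar_U_def by fastforce
    then show "class_B n \<mu> \<nu> t b ` L
      \<subseteq> {x \<in> carrier (ring_B n \<mu> \<nu> t b). B_to_U n \<mu> \<nu> t b x \<in> (Lbar_U n \<mu> \<nu> t b \<sigma> :: 'k mpoly set set)}"
      using LB by blast
  qed
  then have sub: "B_to_U n \<mu> \<nu> t b ` Lbar_B n \<mu> \<nu> t b \<sigma> \<subseteq> (Lbar_U n \<mu> \<nu> t b \<sigma> :: 'k mpoly set set)"
    by blast
  show ?thesis
    unfolding class_B_mod_L_def class_U_mod_L_def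
      induced_class[OF ideal_Lbar_B ideal_Lbar_U hom sub presentsD(5)[OF presents_B p]] B_to_U_class[OF p] ..
qed

lemma phi_class:
  fixes p :: "'k::field mpoly"
  assumes p: "p \<in> carrier (poly_ring SC)"
  shows "phi n \<mu> \<nu> t b \<sigma> (G +>\<^bsub>poly_ring SC\<^esub> p) = class_B_mod_L n \<mu> \<nu> t b \<sigma> p"
proof -
  have "class_B n \<mu> \<nu> t b ` G \<subseteq> (Lbar_B n \<mu> \<nu> t b \<sigma> :: 'k mpoly set set)"
    using class_in_ideal_if_relation[OF presents_B _ ideal_Lbar_B] presents_B_mod_L G_eq KS_Kc
    unfolding class_B_mod_L_def[abs_def] ring_B_mod_L_def by blast
  from induced_class[OF ideal_ideal_G ideal_Lbar_B restrict_poly_ring_hom[OF presentsD(2)[OF presents_B] SC_cvars] this p]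
  show ?thesis unfolding phi_def class_B_mod_L_def .
qed

lemma vartheta_class:
  fixes p :: "'k::field mpoly"
  assumes p: "p \<in> carrier (KxS n \<mu> \<nu> \<eta> t b \<sigma>)"
  shows "vartheta n \<mu> \<nu> t b \<sigma> (class_UG n \<mu> \<nu> \<eta> t b \<sigma> p) = class_U_mod_L n \<mu> \<nu> t b \<sigma> p"
proof -
  have V: "xvars n \<union> SC \<subseteq> xvars n \<union> cvars \<mu> \<nu>" using SC_cvars by blast
  have "class_U n \<mu> \<nu> t b ` UG \<subseteq> (Lbar_U n \<mu> \<nu> t b \<sigma> :: 'k mpoly set set)"
    using class_in_ideal_if_relation[OF presents_U _ ideal_Lbar_U] presents_U_mod_L UG_W KxS_Kxc
    unfolding class_U_mod_L_def[abs_def] ring_U_mod_L_def by blast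
  from induced_class[OF ideal_ideal_UG ideal_Lbar_U restrict_poly_ring_hom[OF presentsD(2)[OF presents_U] V] this p]
  have "induced (ring_U n \<mu> \<nu> t b) (Lbar_U n \<mu> \<nu> t b \<sigma>) (class_U n \<mu> \<nu> t b) (class_UG n \<mu> \<nu> \<eta> t b \<sigma> p)
    = class_U_mod_L n \<mu> \<nu> t b \<sigma> p" unfolding class_UG_def class_U_mod_L_def .
  moreover have "class_U n \<mu> \<nu> t b \<circ> Theta = (class_U n \<mu> \<nu> t b :: 'k mpoly \<Rightarrow> 'k mpoly set)"
    by (simp add: fun_eq_iff Theta_def)
  ultimately show ?thesis by (simp add: vartheta_def)
qed

lemma G_to_UG_class:
  fixes p :: "'k::field mpoly"
  assumes "p \<in> carrier (poly_ring SC)"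
  shows "induced (KxS n \<mu> \<nu> \<eta> t b \<sigma>) UG id (G +>\<^bsub>poly_ring SC\<^esub> p) = class_UG n \<mu> \<nu> \<eta> t b \<sigma> p"
proof -
  have sub: "id ` G \<subseteq> (UG :: 'k mpoly set)" using gens_UG(1) by simp
  have hom: "id \<in> Ring.ring_hom (poly_ring SC) (KxS n \<mu> \<nu> \<eta> t b \<sigma> :: 'k mpoly ring)"
    by (rule id_poly_ring_hom) simp
  show ?thesis
    unfolding induced_class[OF ideal_ideal_G ideal_ideal_UG hom sub assms] class_UG_def id_apply ..
qed

lemma U_mod_L_basis:
  "module_basis (ring_B_mod_L n \<mu> \<nu> t b \<sigma> :: 'k::field mpoly set set ring)
     (module_U_mod_L n \<mu> \<nu> t b \<sigma>) Ord (\<lambda>s. class_U_mod_L n \<mu> \<nu> t b \<sigma> (of_term s))"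
  unfolding module_U_mod_L_def
proof (rule module_basis_presented[OF presents_B_mod_L presents_U_mod_L _ B_mod_L_to_U_mod_L_class finite_Ord of_term_t_Kxc])
  fix p :: "'k mpoly" assume "p \<in> carrier (Kxc n \<mu> \<nu>)"
  from spans_mod_W[OF this]
  show "\<exists>a. (\<forall>s\<in>Ord. a s \<in> carrier (Kc \<mu> \<nu>)) \<and> p - (\<Sum>s\<in>Ord. a s * of_term s) \<in> W"
    by (simp add: spanned_def)
qed (simp_all add: independent_mod_W)

lemma UG_basis:
  "module_basis (ring_G n \<mu> \<nu> \<eta> t b \<sigma> :: 'k::field mpoly set ring)
     (module_UG n \<mu> \<nu> \<eta> t b \<sigma>) Ord (\<lambda>s. class_UG n \<mu> \<nu> \<eta> t b \<sigma> (of_term s))"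
  unfolding module_UG_def
proof (rule module_basis_presented[OF presents_G presents_UG _ G_to_UG_class finite_Ord])
  fix p :: "'k mpoly" assume "p \<in> carrier (KxS n \<mu> \<nu> \<eta> t b \<sigma>)"
  from spans_mod_UG[OF this]
  show "\<exists>a. (\<forall>s\<in>Ord. a s \<in> carrier (poly_ring SC)) \<and> p - (\<Sum>s\<in>Ord. a s * of_term s) \<in> UG"
    by (simp add: spanned_def)
next
  fix a :: "pterm \<Rightarrow> 'k mpoly"
  assume a: "\<forall>s\<in>Ord. a s \<in> carrier (poly_ring SC)" and 0: "(\<Sum>s\<in>Ord. a s * of_term s) \<in> UG"
  have "(\<Sum>s\<in>Ord. a s * of_term s) \<in> W" using 0 UG_W by blast
  then have "\<forall>s\<in>Ord. a s \<in> J" using a KS_Kc by (intro independent_mod_W) auto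
  then show "\<forall>s\<in>Ord. a s \<in> G" using a G_eq by blast
qed (auto intro: of_term_KxS Ord_terms)

lemma phi_iso:
  "(phi n \<mu> \<nu> t b \<sigma> :: 'k::field mpoly set \<Rightarrow> 'k mpoly set set)
     \<in> ring_iso (ring_G n \<mu> \<nu> \<eta> t b \<sigma>) (ring_B_mod_L n \<mu> \<nu> t b \<sigma>)"
  by (rule ring_iso_between_presented[OF presents_G presents_B_mod_L SC_cvars phi_class])
    (simp_all add: G_eq Kc_eliminable)

text \<open>
  For surjectivity, expand \<open>p\<close> along \<open>Ord\<close> modulo \<open>W\<close>: replacing the coefficients by congruent
  polynomials in the corner coefficients changes the expansion only by an element of \<open>W\<close>.
\<close>

lemma vartheta_iso:
  "(vartheta n \<mu> \<nu> t b \<sigma> :: 'k::field mpoly set \<Rightarrow> 'k mpoly set set)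
     \<in> ring_iso (ring_UG n \<mu> \<nu> \<eta> t b \<sigma>) (ring_U_mod_L n \<mu> \<nu> t b \<sigma>)"
proof (rule ring_iso_between_presented[OF presents_UG presents_U_mod_L _ vartheta_class])
  show "xvars n \<union> SC \<subseteq> xvars n \<union> cvars \<mu> \<nu>" using SC_cvars by blast
  show "W \<inter> carrier (KxS n \<mu> \<nu> \<eta> t b \<sigma>) \<subseteq> (UG :: 'k mpoly set)" unfolding UG_eq by blast
  fix p :: "'k mpoly" assume "p \<in> carrier (Kxc n \<mu> \<nu>)"
  from spans_mod_W[OF this] obtain a where a: "\<forall>s\<in>Ord. a s \<in> carrier (Kc \<mu> \<nu>)"
    "p - (\<Sum>s\<in>Ord. a s * of_term s) \<in> W" by (auto simp: spanned_def)
  have "\<forall>s\<in>Ord. \<exists>q. q \<in> carrier (poly_ring SC) \<and> a s - q \<in> J"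
    using Kc_eliminable a(1) by blast
  from bchoice[OF this] obtain q where
    q: "\<forall>s\<in>Ord. q s \<in> carrier (poly_ring SC)" "\<forall>s\<in>Ord. a s - q s \<in> J" by blast
  have "(\<Sum>s\<in>Ord. of_term s * (a s - q s)) \<in> W"
    using q(2) J_W by (intro ideal_poly_sum[OF ideal_W] ideal_poly_mult[OF ideal_W] of_term_t_Kxc) auto
  then have "(\<Sum>s\<in>Ord. a s * of_term s) - (\<Sum>s\<in>Ord. q s * of_term s) \<in> W"
    by (simp add: sum_subtractf right_diff_distrib mult.commute)
  from ideal_poly_trans[OF ideal_W a(2) this]
  have "p - (\<Sum>s\<in>Ord. q s * of_term s) \<in> W" .
  moreover have "(\<Sum>s\<in>Ord. q s * of_term s) \<in> carrier (KxS n \<mu> \<nu> \<eta> t b \<sigma>)"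
    using q(1) KS_KxS by (intro poly_ring_sum poly_ring_mult of_term_KxS Ord_terms) auto
  ultimately show "\<exists>q\<in>carrier (KxS n \<mu> \<nu> \<eta> t b \<sigma>). p - q \<in> W" by blast
qed

end

theorem theorem2p9:
  fixes n \<mu> \<nu> \<eta> :: nat and Ord :: "pterm set" and t b :: "nat \<Rightarrow> pterm" and \<sigma> :: "pterm rel"
  assumes "labelled_order_ideal n Ord \<mu> \<nu> \<eta> t b" and "Ord \<noteq> {}" and "term_ordering n \<sigma>"
  shows
    "module_basis (ring_B_mod_L n \<mu> \<nu> t b \<sigma> :: 'k::field mpoly set set ring)
       (module_U_mod_L n \<mu> \<nu> t b \<sigma>)
       Ord (\<lambda>s. class_U_mod_L n \<mu> \<nu> t b \<sigma> (of_term s))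
   \<and> module_basis (ring_G n \<mu> \<nu> \<eta> t b \<sigma> :: 'k mpoly set ring)
       (module_UG n \<mu> \<nu> \<eta> t b \<sigma>)
       Ord (\<lambda>s. class_UG n \<mu> \<nu> \<eta> t b \<sigma> (of_term s))
   \<and> (ideal_UG n \<mu> \<nu> \<eta> t b \<sigma> :: 'k mpoly set) =
       {p \<in> carrier (KxS n \<mu> \<nu> \<eta> t b \<sigma>). Theta p \<in> Idl\<^bsub>Kxc n \<mu> \<nu>\<^esub>
          (ideal_L \<mu> \<nu> t b \<sigma> \<union> ideal_B n \<mu> \<nu> t b \<union> generic_prebasis \<mu> t b ` {..<\<nu>})}
   \<and> (phi n \<mu> \<nu> t b \<sigma> :: 'k mpoly set \<Rightarrow> 'k mpoly set set)
       \<in> ring_iso (ring_G n \<mu> \<nu> \<eta> t b \<sigma>) (ring_B_mod_L n \<mu> \<nu> t b \<sigma>)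
   \<and> (vartheta n \<mu> \<nu> t b \<sigma> :: 'k mpoly set \<Rightarrow> 'k mpoly set set)
       \<in> ring_iso (ring_UG n \<mu> \<nu> \<eta> t b \<sigma>) (ring_U_mod_L n \<mu> \<nu> t b \<sigma>)"
proof -
  interpret labelled_terms_ordered n \<mu> \<nu> \<eta> Ord t b \<sigma>
    by unfold_locales (fact assms)+
  show ?thesis
    using U_mod_L_basis UG_basis UG_eq phi_iso vartheta_iso unfolding Theta_def W_def by blast
qed

end
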